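(* If a Polish group has weak Property (T), then it has Property (FH). Conversely, if a Polish group is $\sigma$-bounded and has Property (FH), then it has weak Property (T).
   Context: A subset of a topological group $G$ is bounded if it has finite diameter for every continuous left-invariant pseudometric on $G$. $G$ is $\sigma$-bounded if it can be covered by countably many bounded sets with the Baire property. A strongly continuous unitary representation $\pi:G\to\mathcal{U}(\mathcal{H})$ almost has invariant vectors in the bounded sense if for every $\varepsilon>0$ and every bounded set $Q\subseteq G$ there is a unit vector $\xi\in\mathcal{H}$ with $\sup_{g\in Q}\|\pi(g)\xi-\xi\|<\varepsilon$. $G$ has weak Property (T) if every strongly continuous unitary representation of $G$ almost having invariant vectors in the bounded sense has a non-zero invariant vector. $G$ has Property (FH) if every continuous action of $G$ by affine isometries on any Hilbert space has a fixed point. *)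

theory Defs
  imports
    "HOL-Analysis.Analysis"
    "HOL-Algebra.Module"
begin

text \<open>
  Topological groups are types of class \<open>topological_group_add\<close>. That class does not assume
  commutativity: the group law is written \<open>+\<close>, its unit \<open>0\<close>. A Polish group is a type of
  class \<open>topological_group_add\<close> and \<open>polish_space\<close>; the latter class fixes a complete metric
  inducing the topology, but no notion below refers to that metric.
\<close>

section \<open>Bounded sets and the Baire property\<close>

definition continuous_left_invariant_pseudometric ::
  "('g::topological_group_add \<Rightarrow> 'g \<Rightarrow> real) \<Rightarrow> bool" where
  "continuous_left_invariant_pseudometric d \<longleftrightarrow>
     (\<forall>x y. 0 \<le> d x y) \<and>
     (\<forall>x. d x x = 0) \<and>
     (\<forall>x y. d x y = d y x) \<and>
     (\<forall>x y z. d x z \<le> d x y + d y z) \<and>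
     (\<forall>g x y. d (g + x) (g + y) = d x y) \<and>
     continuous_on UNIV (\<lambda>(x, y). d x y)"

text \<open>Not to be confused with \<^const>\<open>bounded\<close>, which refers to one fixed metric.\<close>

definition group_bounded :: "'g::topological_group_add set \<Rightarrow> bool" where
  "group_bounded A \<longleftrightarrow>
     (\<forall>d. continuous_left_invariant_pseudometric d \<longrightarrow> bdd_above {d x y | x y. x \<in> A \<and> y \<in> A})"

definition nowhere_dense :: "'a::topological_space set \<Rightarrow> bool" where
  "nowhere_dense A \<longleftrightarrow> interior (closure A) = {}"

definition meagre :: "'a::topological_space set \<Rightarrow> bool" where
  "meagre A \<longleftrightarrow> (\<exists>N :: nat \<Rightarrow> 'a set. (\<forall>n. nowhere_dense (N n)) \<and> A = (\<Union>n. N n))"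

definition baire_property :: "'a::topological_space set \<Rightarrow> bool" where
  "baire_property A \<longleftrightarrow> (\<exists>U. open U \<and> meagre ((A - U) \<union> (U - A)))"

definition sigma_bounded :: "'g::topological_group_add itself \<Rightarrow> bool" where
  "sigma_bounded _ \<longleftrightarrow>
     (\<exists>A :: nat \<Rightarrow> 'g set. (\<forall>n. group_bounded (A n) \<and> baire_property (A n)) \<and> (\<Union>n. A n) = UNIV)"

section \<open>Hilbert spaces\<close>

text \<open>
  The properties below quantify over all Hilbert spaces. To make this possible inside a formula,
  a Hilbert space is a structure whose carrier is an arbitrary subset of a type \<open>'v\<close>, and \<open>'v\<close>
  plays the role of a universe. The fields \<^const>\<open>mult\<close> and \<^const>\<open>one\<close> that the record
  \<^typ>\<open>('k, 'v) module\<close> inherits from rings are not used.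
\<close>

record ('k, 'v) inner_product_space = "('k, 'v) module" +
  ip :: "'v \<Rightarrow> 'v \<Rightarrow> 'k"

definition scalars :: "'k::field ring" where
  "scalars = \<lparr>carrier = UNIV, mult = (*), one = 1, zero = 0, add = (+)\<rparr>"

definition hnorm :: "('k::real_normed_field, 'v) inner_product_space \<Rightarrow> 'v \<Rightarrow> real" where
  "hnorm H x = sqrt (norm (ip H x x))"

text \<open>
  Outside the carrier the distance is set to \<open>0\<close>, because the locale \<^locale>\<open>Metric_space\<close> asks
  for symmetry on the whole type.
\<close>

definition hdist :: "('k::real_normed_field, 'v) inner_product_space \<Rightarrow> 'v \<Rightarrow> 'v \<Rightarrow> real" where
  "hdist H x y = (if x \<in> carrier H \<and> y \<in> carrier H then hnorm H (x \<ominus>\<^bsub>H\<^esub> y) else 0)"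

definition htopology :: "('k::real_normed_field, 'v) inner_product_space \<Rightarrow> 'v topology" where
  "htopology H = Metric_space.mtopology (carrier H) (hdist H)"

text \<open>
  The argument \<open>cj\<close> is the conjugation of the scalar field; the inner product is linear in its
  first argument.
\<close>

definition hilbert_space ::
  "('k \<Rightarrow> 'k) \<Rightarrow> ('k::real_normed_field, 'v) inner_product_space \<Rightarrow> bool" where
  "hilbert_space cj H \<longleftrightarrow>
     Module.module scalars H \<and>
     (\<forall>x\<in>carrier H. \<forall>y\<in>carrier H. ip H y x = cj (ip H x y)) \<and>
     (\<forall>x\<in>carrier H. \<forall>y\<in>carrier H. \<forall>z\<in>carrier H.
        ip H (x \<oplus>\<^bsub>H\<^esub> y) z = ip H x z + ip H y z) \<and>
     (\<forall>a. \<forall>x\<in>carrier H. \<forall>y\<in>carrier H. ip H (a \<odot>\<^bsub>H\<^esub> x) y = a * ip H x y) \<and>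
     (\<forall>x\<in>carrier H. ip H x x \<in> \<real>\<^sub>\<ge>\<^sub>0) \<and>
     (\<forall>x\<in>carrier H. ip H x x = 0 \<longrightarrow> x = \<zero>\<^bsub>H\<^esub>) \<and>
     Metric_space.mcomplete (carrier H) (hdist H)"

abbreviation complex_hilbert_space :: "(complex, 'v) inner_product_space \<Rightarrow> bool" where
  "complex_hilbert_space \<equiv> hilbert_space cnj"

abbreviation real_hilbert_space :: "(real, 'v) inner_product_space \<Rightarrow> bool" where
  "real_hilbert_space \<equiv> hilbert_space (\<lambda>t. t)"

section \<open>Unitary representations and weak Property (T)\<close>

definition unitary_operator :: "(complex, 'v) inner_product_space \<Rightarrow> ('v \<Rightarrow> 'v) \<Rightarrow> bool" where
  "unitary_operator H U \<longleftrightarrow>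
     bij_betw U (carrier H) (carrier H) \<and>
     (\<forall>x\<in>carrier H. \<forall>y\<in>carrier H. U (x \<oplus>\<^bsub>H\<^esub> y) = U x \<oplus>\<^bsub>H\<^esub> U y) \<and>
     (\<forall>a. \<forall>x\<in>carrier H. U (a \<odot>\<^bsub>H\<^esub> x) = a \<odot>\<^bsub>H\<^esub> U x) \<and>
     (\<forall>x\<in>carrier H. \<forall>y\<in>carrier H. ip H (U x) (U y) = ip H x y)"

definition unitary_representation ::
  "(complex, 'v) inner_product_space \<Rightarrow> ('g::topological_group_add \<Rightarrow> 'v \<Rightarrow> 'v) \<Rightarrow> bool" where
  "unitary_representation H \<pi> \<longleftrightarrow>
     (\<forall>g. unitary_operator H (\<pi> g)) \<and>
     (\<forall>g h. \<forall>\<xi>\<in>carrier H. \<pi> (g + h) \<xi> = \<pi> g (\<pi> h \<xi>))"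

definition strongly_continuous ::
  "(complex, 'v) inner_product_space \<Rightarrow> ('g::topological_group_add \<Rightarrow> 'v \<Rightarrow> 'v) \<Rightarrow> bool" where
  "strongly_continuous H \<pi> \<longleftrightarrow>
     (\<forall>\<xi>\<in>carrier H. continuous_map euclidean (htopology H) (\<lambda>g. \<pi> g \<xi>))"

text \<open>The supremum is taken in the extended reals, so that it is meaningful for \<open>Q = {}\<close> too.\<close>

definition almost_invariant_vectors_bounded ::
  "(complex, 'v) inner_product_space \<Rightarrow> ('g::topological_group_add \<Rightarrow> 'v \<Rightarrow> 'v) \<Rightarrow> bool" where
  "almost_invariant_vectors_bounded H \<pi> \<longleftrightarrow>
     (\<forall>\<epsilon>>0. \<forall>Q. group_bounded Q \<longrightarrow>
        (\<exists>\<xi>\<in>carrier H. hnorm H \<xi> = 1 \<and>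
           (SUP g\<in>Q. ereal (hnorm H (\<pi> g \<xi> \<ominus>\<^bsub>H\<^esub> \<xi>))) < ereal \<epsilon>))"

definition has_nonzero_invariant_vector ::
  "(complex, 'v) inner_product_space \<Rightarrow> ('g::topological_group_add \<Rightarrow> 'v \<Rightarrow> 'v) \<Rightarrow> bool" where
  "has_nonzero_invariant_vector H \<pi> \<longleftrightarrow>
     (\<exists>\<xi>\<in>carrier H. \<xi> \<noteq> \<zero>\<^bsub>H\<^esub> \<and> (\<forall>g. \<pi> g \<xi> = \<xi>))"

definition weak_property_T :: "'g::topological_group_add itself \<Rightarrow> 'v itself \<Rightarrow> bool" where
  "weak_property_T _ _ \<longleftrightarrow>
     (\<forall>(H :: (complex, 'v) inner_product_space) (\<pi> :: 'g \<Rightarrow> 'v \<Rightarrow> 'v).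
        complex_hilbert_space H \<and> unitary_representation H \<pi> \<and> strongly_continuous H \<pi> \<and>
        almost_invariant_vectors_bounded H \<pi> \<longrightarrow>
        has_nonzero_invariant_vector H \<pi>)"

section \<open>Affine isometric actions and Property (FH)\<close>

text \<open>
  Affine means real-affine, and the Hilbert spaces are real. Complex Hilbert spaces are covered
  through their underlying real Hilbert spaces.
\<close>

definition affine_isometry :: "(real, 'v) inner_product_space \<Rightarrow> ('v \<Rightarrow> 'v) \<Rightarrow> bool" where
  "affine_isometry H f \<longleftrightarrow>
     f ` carrier H \<subseteq> carrier H \<and>
     (\<forall>t. \<forall>x\<in>carrier H. \<forall>y\<in>carrier H.
        f ((1 - t) \<odot>\<^bsub>H\<^esub> x \<oplus>\<^bsub>H\<^esub> t \<odot>\<^bsub>H\<^esub> y) = (1 - t) \<odot>\<^bsub>H\<^esub> f x \<oplus>\<^bsub>H\<^esub> t \<odot>\<^bsub>H\<^esub> f y) \<and>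
     (\<forall>x\<in>carrier H. \<forall>y\<in>carrier H. hdist H (f x) (f y) = hdist H x y)"

definition continuous_affine_isometric_action ::
  "(real, 'v) inner_product_space \<Rightarrow> ('g::topological_group_add \<Rightarrow> 'v \<Rightarrow> 'v) \<Rightarrow> bool" where
  "continuous_affine_isometric_action H \<alpha> \<longleftrightarrow>
     (\<forall>g. affine_isometry H (\<alpha> g)) \<and>
     (\<forall>x\<in>carrier H. \<alpha> 0 x = x) \<and>
     (\<forall>g h. \<forall>x\<in>carrier H. \<alpha> (g + h) x = \<alpha> g (\<alpha> h x)) \<and>
     continuous_map (prod_topology euclidean (htopology H)) (htopology H) (\<lambda>(g, x). \<alpha> g x)"

definition property_FH :: "'g::topological_group_add itself \<Rightarrow> 'v itself \<Rightarrow> bool" where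
  "property_FH _ _ \<longleftrightarrow>
     (\<forall>(H :: (real, 'v) inner_product_space) (\<alpha> :: 'g \<Rightarrow> 'v \<Rightarrow> 'v).
        real_hilbert_space H \<and> continuous_affine_isometric_action H \<alpha> \<longrightarrow>
        (\<exists>x\<in>carrier H. \<forall>g. \<alpha> g x = x))"

end

theory Submission
  imports Defs
begin

text \<open>
  Both directions use that a continuous positive semidefinite kernel on a separable space is a Gram
  matrix in \<open>\<ell>\<^sup>2\<close>. Since \<open>\<ell>\<^sup>2\<close> has the cardinality of the continuum, a representation built there can be
  carried over to any universe that contains a non-zero Hilbert space.

  Let \<open>D\<close> be the orbit pseudometric of the origin under an affine isometric action without fixed
  point. It is unbounded by the circumcentre argument, and the kernels \<open>exp (- D\<^sup>2 / (n + 1))\<close> yield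
  unit vectors that are moved little on bounded sets. They tend to \<open>0\<close> along a sequence on which
  \<open>D\<close> tends to infinity, so there are no invariant vectors.

  Conversely, let \<open>G\<close> be the union of bounded sets \<open>A\<^sub>0, A\<^sub>1, \<dots>\<close> with the Baire property, and let the
  unit vector \<open>\<xi>\<^sub>n\<close> be moved by at most \<open>4\<^sup>-\<^sup>n\<close> on \<open>A\<^sub>0 \<union> \<dots> \<union> A\<^sub>n\<close>. Then \<open>g \<mapsto> (2\<^sup>n (\<pi> g \<xi>\<^sub>n - \<xi>\<^sub>n))\<^sub>n\<close> is a
  cocycle, which is continuous because some \<open>A\<^sub>k - A\<^sub>k\<close> is a neighbourhood of the identity. A fixed
  point of the associated action bounds it, so for large \<open>n\<close> the orbit of \<open>\<xi>\<^sub>n\<close> stays within \<open>1/2\<close> of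
  \<open>\<xi>\<^sub>n\<close>, and its circumcentre is a non-zero invariant vector.
\<close>

section \<open>The sequence space \<open>\<ell>\<^sup>2\<close>\<close>

text \<open>Both properties quantify over the Hilbert spaces inside one type \<open>'v\<close>, so
  an infinite direct sum or an exponential of a given space cannot simply be formed: it may be too
  large for \<open>'v\<close>. Kernels circumvent this. Only the closed span of countably many
  orbits matters. It is separable because the group is, and its Gram matrix determines it together
  with the action, so it can be rebuilt in \<open>ell2\<close>. A non-zero Hilbert space in
  \<open>'v\<close> contains a real line, hence enough points for \<open>ell2 \<times> ell2\<close>.

  A single representation has to serve every bounded set and every \<epsilon>, so the kernels for
  all n are realised at once, as orthogonal blocks. The Gaussian kernels are Schoenberg's: for
  growing n they tend to 1 uniformly on bounded sets, while each of them still vanishes where the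
  distance tends to infinity.

  The rate \<open>4^(-n)\<close> and the weight \<open>2^n\<close> are matched: their product is
  summable, which makes the cocycle converge, and the weight is unbounded, which turns a bound on
  the cocycle into small displacements of late vectors.\<close>

definition square_summable :: "(nat \<Rightarrow> real) \<Rightarrow> bool" where
  "square_summable x \<longleftrightarrow> summable (\<lambda>n. (x n)\<^sup>2)"

lemma square_summable_zero: "square_summable (\<lambda>n. 0)"
  by (simp add: square_summable_def)

lemma square_summable_mult:
  assumes "square_summable x" "square_summable y"
  shows "summable (\<lambda>n. x n * y n)"
proof (rule summable_comparison_test)
  have "\<bar>x n * y n\<bar> \<le> (x n)\<^sup>2 + (y n)\<^sup>2" for n
  proof -
    have "2 * (\<bar>x n\<bar> * \<bar>y n\<bar>) \<le> (x n)\<^sup>2 + (y n)\<^sup>2"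
      using sum_squares_bound[of "\<bar>x n\<bar>" "\<bar>y n\<bar>"] by (simp add: mult.assoc)
    moreover have "0 \<le> \<bar>x n\<bar> * \<bar>y n\<bar>" by simp
    ultimately show ?thesis unfolding abs_mult by linarith
  qed
  then show "\<exists>N. \<forall>n\<ge>N. norm (x n * y n) \<le> (x n)\<^sup>2 + (y n)\<^sup>2" by auto
  show "summable (\<lambda>n. (x n)\<^sup>2 + (y n)\<^sup>2)"
    using assms by (auto simp: square_summable_def intro: summable_add)
qed

lemma square_summable_add:
  assumes "square_summable x" "square_summable y"
  shows "square_summable (\<lambda>n. x n + y n)"
proof -
  have "summable (\<lambda>n. (x n)\<^sup>2 + (y n)\<^sup>2 + 2 * (x n * y n))"
    using assms square_summable_mult[OF assms]
    by (auto simp: square_summable_def intro!: summable_add summable_mult)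
  then show ?thesis by (simp add: square_summable_def power2_sum mult.assoc)
qed

lemma square_summable_scale: "square_summable x \<Longrightarrow> square_summable (\<lambda>n. a * x n)"
  by (simp add: square_summable_def power_mult_distrib summable_mult)

lemma square_summable_diff:
  assumes "square_summable x" "square_summable y"
  shows "square_summable (\<lambda>n. x n - y n)"
  using square_summable_add[OF assms(1) square_summable_scale[OF assms(2), of "-1"]] by simp

text \<open>A type rather than a carrier set, so that the classes \<open>real_inner\<close> and
  \<open>banach\<close> apply. Its closed subspaces are copied into \<open>'v\<close> only at the
  end, by the \<open>transport\<close> locales.\<close>

typedef ell2 = "{x. square_summable x}"
  morphisms coord Abs_ell2
  using square_summable_zero by blast

setup_lifting type_definition_ell2

lemma square_summable_coord: "square_summable (coord x)"
  using coord by simp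

lemma ell2_eqI: "(\<And>n. coord x n = coord y n) \<Longrightarrow> x = y"
  by (simp add: coord_inject[symmetric] fun_eq_iff)

instantiation ell2 :: real_vector
begin

lift_definition zero_ell2 :: ell2 is "\<lambda>n. 0"
  by (rule square_summable_zero)

lift_definition plus_ell2 :: "ell2 \<Rightarrow> ell2 \<Rightarrow> ell2" is "\<lambda>x y n. x n + y n"
  by (rule square_summable_add)

lift_definition minus_ell2 :: "ell2 \<Rightarrow> ell2 \<Rightarrow> ell2" is "\<lambda>x y n. x n - y n"
  by (rule square_summable_diff)

lift_definition uminus_ell2 :: "ell2 \<Rightarrow> ell2" is "\<lambda>x n. - x n"
  by (simp add: square_summable_def)

lift_definition scaleR_ell2 :: "real \<Rightarrow> ell2 \<Rightarrow> ell2" is "\<lambda>a x n. a * x n"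
  by (rule square_summable_scale)

instance
  by standard (transfer, simp add: fun_eq_iff algebra_simps)+

end

instantiation ell2 :: real_inner
begin

definition inner_ell2 :: "ell2 \<Rightarrow> ell2 \<Rightarrow> real" where
  "inner_ell2 x y = (\<Sum>n. coord x n * coord y n)"

definition norm_ell2 :: "ell2 \<Rightarrow> real" where
  "norm_ell2 x = sqrt (inner x x)"

definition sgn_ell2 :: "ell2 \<Rightarrow> ell2" where
  "sgn_ell2 x = x /\<^sub>R norm x"

definition dist_ell2 :: "ell2 \<Rightarrow> ell2 \<Rightarrow> real" where
  "dist_ell2 x y = norm (x - y)"

definition uniformity_ell2 :: "(ell2 \<times> ell2) filter" where
  "uniformity_ell2 = (INF e\<in>{0<..}. principal {(x, y). dist x y < e})"

definition open_ell2 :: "ell2 set \<Rightarrow> bool" where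
  "open_ell2 S \<longleftrightarrow> (\<forall>x\<in>S. \<forall>\<^sub>F (x', y) in uniformity. x' = x \<longrightarrow> y \<in> S)"

instance
proof
  fix x y z :: ell2 and r :: real
  note summable = square_summable_mult[OF square_summable_coord square_summable_coord]
  show "inner x y = inner y x" by (simp add: inner_ell2_def mult.commute)
  show "inner (x + y) z = inner x z + inner y z"
    by (simp add: inner_ell2_def plus_ell2.rep_eq distrib_right suminf_add[OF summable summable])
  show "inner (r *\<^sub>R x) y = r * inner x y"
    by (simp add: inner_ell2_def scaleR_ell2.rep_eq mult.assoc suminf_mult[OF summable])
  show "0 \<le> inner x x"
    unfolding inner_ell2_def by (rule suminf_nonneg[OF summable]) simp
  show "inner x x = 0 \<longleftrightarrow> x = 0"
  proof
    assume "inner x x = 0"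
    then have "\<forall>n. coord x n * coord x n = 0"
      unfolding inner_ell2_def by (subst (asm) suminf_eq_zero_iff[OF summable]) simp_all
    then show "x = 0" by (intro ell2_eqI) (simp add: zero_ell2.rep_eq)
  qed (simp add: inner_ell2_def zero_ell2.rep_eq)
qed (rule norm_ell2_def sgn_ell2_def dist_ell2_def uniformity_ell2_def open_ell2_def)+

end

lemma norm_ell2_square: "(norm (x::ell2))\<^sup>2 = (\<Sum>n. (coord x n)\<^sup>2)"
  by (simp only: power2_norm_eq_inner inner_ell2_def power2_eq_square[symmetric])

lemma sum_coord_le_norm: "(\<Sum>n<N. (coord x n)\<^sup>2) \<le> (norm x)\<^sup>2"
proof -
  have "(\<Sum>n<N. (coord x n)\<^sup>2) \<le> (\<Sum>n. (coord x n)\<^sup>2)"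
    using square_summable_coord[of x] by (intro sum_le_suminf) (auto simp: square_summable_def)
  then show ?thesis by (simp add: norm_ell2_square)
qed

lemma abs_coord_le_norm: "\<bar>coord x n\<bar> \<le> norm x"
proof -
  have "(coord x n)\<^sup>2 \<le> (\<Sum>n<Suc n. (coord x n)\<^sup>2)" by (simp add: sum_nonneg)
  also have "\<dots> \<le> (norm x)\<^sup>2" by (rule sum_coord_le_norm)
  finally show ?thesis by (simp add: abs_le_square_iff[symmetric])
qed

lemma norm_ell2_le:
  assumes "0 \<le> C" "\<And>N. (\<Sum>n<N. (coord x n)\<^sup>2) \<le> C\<^sup>2"
  shows "norm x \<le> C"
proof -
  have "(\<Sum>n. (coord x n)\<^sup>2) \<le> C\<^sup>2"
    using square_summable_coord[of x] assms(2)
    by (intro suminf_le_const) (auto simp: square_summable_def)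
  then have "(norm x)\<^sup>2 \<le> C\<^sup>2"
    by (simp add: norm_ell2_square)
  then show ?thesis using assms(1) by (rule power2_le_imp_le)
qed

instance ell2 :: banach
proof
  fix X :: "nat \<Rightarrow> ell2"
  assume "Cauchy X"
  have "Cauchy (\<lambda>k. coord (X k) n)" for n
  proof (rule metric_CauchyI)
    fix e :: real assume "0 < e"
    from metric_CauchyD[OF \<open>Cauchy X\<close> this] obtain M
      where M: "\<forall>j\<ge>M. \<forall>k\<ge>M. dist (X j) (X k) < e" by blast
    have "dist (coord (X j) n) (coord (X k) n) \<le> dist (X j) (X k)" for j k
      using abs_coord_le_norm[of "X j - X k" n] by (simp add: dist_norm minus_ell2.rep_eq)
    then show "\<exists>M. \<forall>j\<ge>M. \<forall>k\<ge>M. dist (coord (X j) n) (coord (X k) n) < e"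
      using M by (meson le_less_trans)
  qed
  then have "\<forall>n. \<exists>l. (\<lambda>k. coord (X k) n) \<longlonglongrightarrow> l"
    by (simp add: real_Cauchy_convergent convergent_def[symmetric])
  from choice[OF this] obtain l where l: "\<And>n. (\<lambda>k. coord (X k) n) \<longlonglongrightarrow> l n"
    by blast
  \<comment> \<open>The coordinatewise limit \<open>l\<close> is not yet known to be square
    summable, so the estimate is stated for partial sums, with a bound independent of
    \<open>N\<close>. Square summability then follows, because \<open>l\<close> differs from some
    \<open>X M\<close> by a square summable sequence.\<close>
  have tail: "\<exists>M. \<forall>k\<ge>M. \<forall>N. (\<Sum>n<N. (coord (X k) n - l n)\<^sup>2) \<le> e\<^sup>2" if "0 < e" for e
  proof -
    from metric_CauchyD[OF \<open>Cauchy X\<close> that] obtain M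
      where M: "\<forall>j\<ge>M. \<forall>k\<ge>M. dist (X j) (X k) < e" by blast
    have "(\<Sum>n<N. (coord (X k) n - l n)\<^sup>2) \<le> e\<^sup>2" if k: "k \<ge> M" for k N
    proof (rule tendsto_upperbound)
      show "(\<lambda>j. \<Sum>n<N. (coord (X k) n - coord (X j) n)\<^sup>2) \<longlonglongrightarrow> (\<Sum>n<N. (coord (X k) n - l n)\<^sup>2)"
        by (intro tendsto_intros l)
      have "(\<Sum>n<N. (coord (X k) n - coord (X j) n)\<^sup>2) \<le> e\<^sup>2" if "j \<ge> M" for j
      proof -
        have "norm (X k - X j) \<le> e" using M k that by (simp add: dist_norm less_imp_le)
        then have "(norm (X k - X j))\<^sup>2 \<le> e\<^sup>2" by (simp add: power_mono)
        then show ?thesis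
          using sum_coord_le_norm[of "X k - X j" N] by (simp add: minus_ell2.rep_eq)
      qed
      then show "\<forall>\<^sub>F j in sequentially. (\<Sum>n<N. (coord (X k) n - coord (X j) n)\<^sup>2) \<le> e\<^sup>2"
        using eventually_sequentially by blast
    qed simp
    then show ?thesis by blast
  qed
  from tail[of 1] obtain M where M: "\<And>N. (\<Sum>n<N. (coord (X M) n - l n)\<^sup>2) \<le> 1" by auto
  have "square_summable (\<lambda>n. coord (X M) n - l n)"
    unfolding square_summable_def
    by (rule summableI_nonneg_bounded[where x = 1]) (use M in auto)
  from square_summable_diff[OF square_summable_coord[of "X M"] this]
  have ss: "square_summable l" by simp
  define L where "L = Abs_ell2 l"
  have coord_L: "coord L = l" using ss by (simp add: L_def Abs_ell2_inverse)
  have "X \<longlonglongrightarrow> L"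
  proof (rule metric_LIMSEQ_I)
    fix r :: real assume "0 < r"
    then obtain M where M: "\<forall>k\<ge>M. \<forall>N. (\<Sum>n<N. (coord (X k) n - l n)\<^sup>2) \<le> (r/2)\<^sup>2"
      using tail[of "r/2"] by auto
    have "dist (X k) L < r" if "k \<ge> M" for k
    proof -
      have "norm (X k - L) \<le> r/2"
        using M that \<open>0 < r\<close> by (intro norm_ell2_le) (auto simp: minus_ell2.rep_eq coord_L)
      then show ?thesis using \<open>0 < r\<close> by (simp add: dist_norm)
    qed
    then show "\<exists>M. \<forall>k\<ge>M. dist (X k) L < r" by blast
  qed
  then show "convergent X" by (auto simp: convergent_def)
qed

text \<open>A pair of sequences is a countable array of reals, each coded by a set of naturals. The
  first sequence fills the even rows and the second the odd rows of a subset of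
  \<open>nat \<times> nat\<close>, which is coded by one real.\<close>

lemma ex_inj_ell2_prod_real: "\<exists>f :: ell2 \<times> ell2 \<Rightarrow> real. inj f"
proof -
  obtain s :: "real \<Rightarrow> nat set" where s: "inj s"
    using nat_sets_eqpoll_reals by (metis bij_betw_def eqpoll_def eqpoll_sym)
  obtain r :: "nat set \<Rightarrow> real" where r: "inj r"
    using nat_sets_eqpoll_reals by (metis bij_betw_def eqpoll_def)
  define code :: "ell2 \<times> ell2 \<Rightarrow> (nat \<times> nat) set" where
    "code p = {(2 * n, i) |n i. i \<in> s (coord (fst p) n)} \<union> {(2 * n + 1, i) |n i. i \<in> s (coord (snd p) n)}"
    for p
  have fst_code: "s (coord (fst p) n) = {i. (2 * n, i) \<in> code p}" for p n
    by (auto simp: code_def) presburger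
  have snd_code: "s (coord (snd p) n) = {i. (2 * n + 1, i) \<in> code p}" for p n
    by (auto simp: code_def) presburger
  have "inj code"
  proof (rule injI)
    fix p q assume "code p = code q"
    then have "s (coord (fst p) n) = s (coord (fst q) n)" "s (coord (snd p) n) = s (coord (snd q) n)" for n
      by (simp_all only: fst_code snd_code)
    then show "p = q"
      using injD[OF s] by (intro prod_eqI ell2_eqI) blast+
  qed
  moreover have "inj (\<lambda>A. prod_encode ` A)"
    by (intro injI) (simp add: inj_image_eq_iff[OF inj_prod_encode])
  ultimately have "inj (r \<circ> (\<lambda>A. prod_encode ` A) \<circ> code)"
    using r by (intro inj_compose)
  then show ?thesis by blast
qed

section \<open>Positive semidefinite kernels\<close>

text \<open>The points \<open>x i\<close> need not be distinct, which makes positivity stable under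
  composition with an arbitrary map. Symmetry is a separate condition, since a real quadratic form
  sees only the symmetric part of \<open>K\<close>.\<close>

definition psd_kernel :: "('x \<Rightarrow> 'x \<Rightarrow> real) \<Rightarrow> bool" where
  "psd_kernel K \<longleftrightarrow>
     (\<forall>x y. K x y = K y x) \<and>
     (\<forall>(n::nat) x c. 0 \<le> (\<Sum>i<n. \<Sum>j<n. c i * c j * K (x i) (x j)))"

lemma psd_kernel_sym: "psd_kernel K \<Longrightarrow> K x y = K y x"
  by (simp add: psd_kernel_def)

lemma psd_kernel_nonneg:
  fixes n :: nat
  shows "psd_kernel K \<Longrightarrow> 0 \<le> (\<Sum>i<n. \<Sum>j<n. c i * c j * K (x i) (x j))"
  by (simp add: psd_kernel_def)

lemma psd_kernel_reindex: "psd_kernel K \<Longrightarrow> psd_kernel (\<lambda>x y. K (f x) (f y))"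
  using psd_kernel_sym[of K] psd_kernel_nonneg[of K, where x = "\<lambda>i. f (x i)" for x]
  by (simp add: psd_kernel_def)

lemma psd_kernel_diag: "psd_kernel K \<Longrightarrow> 0 \<le> K a a"
  using psd_kernel_nonneg[of K, where n = 1 and c = "\<lambda>_. 1" and x = "\<lambda>_. a"] by simp

text \<open>This is the form on \<open>n + 1\<close> points, read as a quadratic polynomial in the
  coefficient \<open>s\<close> of the additional point \<open>a\<close>. Suitable values of
  \<open>s\<close> yield the two facts that elimination rests on.\<close>

lemma psd_kernel_extend_nonneg:
  fixes n :: nat
  assumes "psd_kernel K"
  shows "0 \<le> (\<Sum>i<n. \<Sum>j<n. c i * c j * K (x i) (x j))
             + 2 * s * (\<Sum>i<n. c i * K (x i) a) + s\<^sup>2 * K a a"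
proof -
  define x' where "x' i = (if i < n then x i else a)" for i
  define c' where "c' i = (if i < n then c i else s)" for i
  have "0 \<le> (\<Sum>i<Suc n. \<Sum>j<Suc n. c' i * c' j * K (x' i) (x' j))"
    by (rule psd_kernel_nonneg[OF assms])
  also have "\<dots> = (\<Sum>i<n. \<Sum>j<n. c i * c j * K (x i) (x j)) + (\<Sum>i<n. c i * s * K (x i) a)
      + (\<Sum>j<n. s * c j * K a (x j)) + s * s * K a a"
    by (simp add: x'_def c'_def sum.distrib)
  also have "(\<Sum>j<n. s * c j * K a (x j)) = (\<Sum>j<n. c j * s * K (x j) a)"
    by (simp add: psd_kernel_sym[OF assms, of a] mult.commute)
  also have "(\<Sum>j<n. c j * s * K (x j) a) = s * (\<Sum>i<n. c i * K (x i) a)"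
    by (simp add: sum_distrib_left mult_ac)
  finally show ?thesis by (simp add: power2_eq_square)
qed

lemma psd_kernel_diag_zero:
  assumes "psd_kernel K" "K a a = 0"
  shows "K x a = 0"
proof (rule ccontr)
  assume "K x a \<noteq> 0"
  \<comment> \<open>With \<open>K a a = 0\<close> the form is affine in \<open>s\<close>; this value
    brings it down to -1.\<close>
  define s where "s = - (K x x + 1) / (2 * K x a)"
  have "2 * s * K x a = - (K x x + 1)"
    using \<open>K x a \<noteq> 0\<close> by (simp add: s_def)
  moreover have "0 \<le> K x x + 2 * s * K x a"
    using psd_kernel_extend_nonneg[OF assms(1), where n = 1 and c = "\<lambda>_. 1" and x = "\<lambda>_. x" and s = s and a = a] assms(2) by simp
  ultimately show False by simp
qed

text \<open>One step of the Cholesky decomposition; for \<open>K a a = 0\<close> the quotient is \<open>0\<close>, as it should be.\<close>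

definition schur_complement :: "('x \<Rightarrow> 'x \<Rightarrow> real) \<Rightarrow> 'x \<Rightarrow> 'x \<Rightarrow> 'x \<Rightarrow> real" where
  "schur_complement K a x y = K x y - K x a * K y a / K a a"

text \<open>For \<open>K a a \<noteq> 0\<close> the form of the Schur complement is the minimum over
  \<open>s\<close> of the form with \<open>a\<close> adjoined, attained at
  \<open>s = - B / K a a\<close>.\<close>

lemma psd_schur_complement:
  assumes "psd_kernel K"
  shows "psd_kernel (schur_complement K a)"
  unfolding psd_kernel_def
proof (intro conjI allI)
  show "schur_complement K a x y = schur_complement K a y x" for x y
    by (simp add: schur_complement_def psd_kernel_sym[OF assms, of x y] mult.commute)
next
  fix n :: nat and x :: "nat \<Rightarrow> 'a" and c :: "nat \<Rightarrow> real"
  define B where "B = (\<Sum>i<n. c i * K (x i) a)"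
  have "(\<Sum>i<n. \<Sum>j<n. c i * c j * schur_complement K a (x i) (x j))
      = (\<Sum>i<n. \<Sum>j<n. c i * c j * K (x i) (x j))
        - (\<Sum>i<n. \<Sum>j<n. (c i * K (x i) a) * (c j * K (x j) a) / K a a)"
    by (simp add: schur_complement_def sum_subtractf[symmetric] right_diff_distrib mult_ac)
  also have "(\<Sum>i<n. \<Sum>j<n. (c i * K (x i) a) * (c j * K (x j) a) / K a a) = B * B / K a a"
    by (simp add: B_def sum_product sum_divide_distrib)
  also have "0 \<le> (\<Sum>i<n. \<Sum>j<n. c i * c j * K (x i) (x j)) - B * B / K a a"
  proof (cases "K a a = 0")
    case True
    then show ?thesis using psd_kernel_nonneg[OF assms] by simp
  next
    case False
    then show ?thesis
      using psd_kernel_extend_nonneg[OF assms, where n = n and c = c and x = x and s = "- B / K a a" and a = a]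
      by (simp add: B_def[symmetric] power2_eq_square)
  qed
  finally show "0 \<le> (\<Sum>i<n. \<Sum>j<n. c i * c j * schur_complement K a (x i) (x j))" .
qed

text \<open>Elimination point by point: \<open>S k\<close> is what remains of \<open>K\<close> once
  the points below \<open>k\<close> are eliminated, and it vanishes on their rows, so the sum over
  \<open>l < N\<close> is exact as soon as \<open>i < N\<close>. Column \<open>l\<close> of
  \<open>L\<close> is the normalised pivot column of \<open>S l\<close>. A zero pivot has a zero
  column, in agreement with division by 0.\<close>

lemma cholesky:
  fixes K :: "nat \<Rightarrow> nat \<Rightarrow> real"
  assumes "psd_kernel K"
  shows "\<exists>L :: nat \<Rightarrow> nat \<Rightarrow> real. (\<forall>i l. i < l \<longrightarrow> L i l = 0) \<and>
           (\<forall>i j N. i < N \<longrightarrow> j < N \<longrightarrow> K i j = (\<Sum>l<N. L i l * L j l))"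
proof -
  define S where "S = rec_nat K (\<lambda>k T. schur_complement T k)"
  define L where "L i l = S l i l / sqrt (S l l l)" for i l
  have S_0: "S 0 = K" and S_Suc: "S (Suc k) = schur_complement (S k) k" for k
    by (simp_all add: S_def)
  have psd: "psd_kernel (S k)" for k
    by (induction k) (simp_all add: S_0 S_Suc assms psd_schur_complement)
  have vanish: "S k i j = 0" if "i < k" for k i j
    using that
  proof (induction k arbitrary: i j)
    case (Suc k)
    show ?case
    proof (cases "i = k")
      case True
      show ?thesis
      proof (cases "S k k k = 0")
        case True
        then show ?thesis
          using psd_kernel_diag_zero[OF psd True] \<open>i = k\<close> psd_kernel_sym[OF psd[of k], of k j]
          by (simp add: S_Suc schur_complement_def)
      next
        case False
        then show ?thesis
          using \<open>i = k\<close> psd_kernel_sym[OF psd[of k], of k j] by (simp add: S_Suc schur_complement_def)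
      qed
    next
      case False
      then show ?thesis using Suc by (simp add: S_Suc schur_complement_def)
    qed
  qed simp
  have decomp: "K i j = (\<Sum>l<k. L i l * L j l) + S k i j" for k i j
  proof (induction k)
    case (Suc k)
    have "L i k * L j k = S k i k * S k j k / S k k k"
      using psd_kernel_diag[OF psd, of k k] by (simp add: L_def)
    then show ?case using Suc by (simp add: S_Suc schur_complement_def)
  qed (simp add: S_0)
  show ?thesis
  proof (intro exI[of _ L] conjI allI impI)
    show "L i l = 0" if "i < l" for i l using vanish[OF that] by (simp add: L_def)
    show "K i j = (\<Sum>l<N. L i l * L j l)" if "i < N" "j < N" for i j N
      using decomp[of i j N] vanish[OF that(1)] by simp
  qed
qed

text \<open>Schur's product theorem. The Cholesky factor splits \<open>K\<close> into rank-one
  kernels, and multiplying \<open>K'\<close> by one of these merely changes the coefficients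
  \<open>c i\<close> into \<open>c i * L i l\<close>.\<close>

lemma psd_kernel_mult:
  assumes "psd_kernel K" "psd_kernel K'"
  shows "psd_kernel (\<lambda>x y. K x y * K' x y)"
  unfolding psd_kernel_def
proof (intro conjI allI)
  show "K x y * K' x y = K y x * K' y x" for x y
    by (metis psd_kernel_sym assms)
next
  fix n :: nat and x :: "nat \<Rightarrow> 'a" and c :: "nat \<Rightarrow> real"
  obtain L :: "nat \<Rightarrow> nat \<Rightarrow> real"
    where "\<forall>i j N. i < N \<longrightarrow> j < N \<longrightarrow> K (x i) (x j) = (\<Sum>l<N. L i l * L j l)"
    using cholesky[OF psd_kernel_reindex[OF assms(1), of x]] by (elim exE conjE) (rule that)
  then have L: "K (x i) (x j) = (\<Sum>l<n. L i l * L j l)" if "i < n" "j < n" for i j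
    using that by simp
  have "(\<Sum>i<n. \<Sum>j<n. c i * c j * (K (x i) (x j) * K' (x i) (x j)))
      = (\<Sum>i<n. \<Sum>j<n. \<Sum>l<n. (c i * L i l) * (c j * L j l) * K' (x i) (x j))"
    by (intro sum.cong refl) (simp add: L sum_distrib_left sum_distrib_right mult_ac)
  also have "\<dots> = (\<Sum>i<n. \<Sum>l<n. \<Sum>j<n. (c i * L i l) * (c j * L j l) * K' (x i) (x j))"
    by (rule sum.cong[OF refl], rule sum.swap)
  also have "\<dots> = (\<Sum>l<n. \<Sum>i<n. \<Sum>j<n. (c i * L i l) * (c j * L j l) * K' (x i) (x j))"
    by (rule sum.swap)
  also have "0 \<le> \<dots>"
    by (rule sum_nonneg) (rule psd_kernel_nonneg[OF assms(2)])
  finally show "0 \<le> (\<Sum>i<n. \<Sum>j<n. c i * c j * (K (x i) (x j) * K' (x i) (x j)))" .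
qed

lemma psd_kernel_product: "psd_kernel (\<lambda>x y. f x * f y)"
proof -
  have "(\<Sum>i<n. \<Sum>j<n. c i * c j * (f (x i) * f (x j))) = (\<Sum>i<n. c i * f (x i))\<^sup>2"
    for n :: nat and c x
    by (simp add: power2_eq_square sum_product mult_ac)
  then show ?thesis by (simp add: psd_kernel_def mult.commute)
qed

lemma psd_kernel_power:
  assumes "psd_kernel K"
  shows "psd_kernel (\<lambda>x y. K x y ^ m)"
proof (induction m)
  case 0
  show ?case using psd_kernel_product[of "\<lambda>_. 1"] by simp
next
  case (Suc m)
  show ?case using psd_kernel_mult[OF assms Suc] by simp
qed

lemma psd_kernel_scale:
  assumes "psd_kernel K" "0 \<le> a"
  shows "psd_kernel (\<lambda>x y. a * K x y)"
  using psd_kernel_mult[OF psd_kernel_product[of "\<lambda>_. sqrt a"] assms(1)] assms(2) by simp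

lemma psd_kernel_sum:
  fixes K :: "'i \<Rightarrow> 'x \<Rightarrow> 'x \<Rightarrow> real"
  assumes "\<And>m. m \<in> A \<Longrightarrow> psd_kernel (K m)"
  shows "psd_kernel (\<lambda>x y. \<Sum>m\<in>A. K m x y)"
  unfolding psd_kernel_def
proof (intro conjI allI)
  show "(\<Sum>m\<in>A. K m x y) = (\<Sum>m\<in>A. K m y x)" for x y
    by (rule sum.cong[OF refl]) (rule psd_kernel_sym[OF assms])
next
  fix n :: nat and x :: "nat \<Rightarrow> 'x" and c :: "nat \<Rightarrow> real"
  have "(\<Sum>i<n. \<Sum>j<n. c i * c j * (\<Sum>m\<in>A. K m (x i) (x j)))
      = (\<Sum>i<n. \<Sum>m\<in>A. \<Sum>j<n. c i * c j * K m (x i) (x j))"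
    by (simp add: sum_distrib_left sum.swap[of _ A])
  also have "\<dots> = (\<Sum>m\<in>A. \<Sum>i<n. \<Sum>j<n. c i * c j * K m (x i) (x j))"
    by (rule sum.swap)
  also have "0 \<le> \<dots>" by (rule sum_nonneg) (rule psd_kernel_nonneg[OF assms])
  finally show "0 \<le> (\<Sum>i<n. \<Sum>j<n. c i * c j * (\<Sum>m\<in>A. K m (x i) (x j)))" .
qed

lemma psd_kernel_LIMSEQ:
  assumes "\<And>m. psd_kernel (K m)" "\<And>x y. (\<lambda>m. K m x y) \<longlonglongrightarrow> K' x y"
  shows "psd_kernel K'"
  unfolding psd_kernel_def
proof (intro conjI allI)
  show "K' x y = K' y x" for x y
    using assms(2)[of x y] assms(2)[of y x] psd_kernel_sym[OF assms(1), of _ x y]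
    by (simp add: LIMSEQ_unique)
next
  fix n :: nat and x :: "nat \<Rightarrow> 'a" and c :: "nat \<Rightarrow> real"
  have "(\<lambda>m. \<Sum>i<n. \<Sum>j<n. c i * c j * K m (x i) (x j))
          \<longlonglongrightarrow> (\<Sum>i<n. \<Sum>j<n. c i * c j * K' (x i) (x j))"
    by (intro tendsto_intros assms(2))
  then show "0 \<le> (\<Sum>i<n. \<Sum>j<n. c i * c j * K' (x i) (x j))"
    by (rule LIMSEQ_le_const) (use psd_kernel_nonneg[OF assms(1)] in blast)
qed

lemma psd_kernel_exp:
  assumes "psd_kernel K"
  shows "psd_kernel (\<lambda>x y. exp (K x y))"
proof (rule psd_kernel_LIMSEQ)
  show "psd_kernel (\<lambda>x y. \<Sum>k<m. inverse (fact k) * K x y ^ k)" for m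
    by (intro psd_kernel_sum psd_kernel_scale psd_kernel_power assms) simp
  show "(\<lambda>m. \<Sum>k<m. inverse (fact k) * K x y ^ k) \<longlonglongrightarrow> exp (K x y)" for x y
    using exp_converges[of "K x y"] by (simp add: sums_def)
qed

text \<open>Schoenberg's kernel: the bracket is the squared distance of Gram vectors of
  \<open>K\<close>. Its diagonal terms contribute a rank-one factor, and the mixed term the
  exponential of a positive semidefinite kernel.\<close>

lemma psd_kernel_gaussian:
  assumes "psd_kernel K" "0 \<le> t"
  shows "psd_kernel (\<lambda>x y. exp (- (t * (K x x - 2 * K x y + K y y))))"
proof -
  have "psd_kernel (\<lambda>x y. exp (- (t * K x x)) * exp (- (t * K y y)) * exp (2 * t * K x y))"
    using assms by (intro psd_kernel_mult[OF psd_kernel_product] psd_kernel_exp psd_kernel_scale) auto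
  moreover have "exp (- (t * K x x)) * exp (- (t * K y y)) * exp (2 * t * K x y)
      = exp (- (t * (K x x - 2 * K x y + K y y)))" for x y
    by (simp add: exp_add[symmetric] algebra_simps)
  ultimately show ?thesis by simp
qed

text \<open>The kernel of an orthogonal direct sum: points with different second component are
  orthogonal. The form splits over the finite set \<open>A\<close> of blocks that are met, with the
  coefficients \<open>d p\<close> cut down to block \<open>p\<close>.\<close>

lemma psd_kernel_block:
  fixes K :: "'i \<Rightarrow> 'x \<Rightarrow> 'x \<Rightarrow> real"
  assumes "\<And>n. psd_kernel (K n)"
  shows "psd_kernel (\<lambda>p q. if snd p = snd q then K (snd p) (fst p) (fst q) else 0)"
  unfolding psd_kernel_def
proof (intro conjI allI)
  show "(if snd p = snd q then K (snd p) (fst p) (fst q) else 0)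
      = (if snd q = snd p then K (snd q) (fst q) (fst p) else 0)" for p q
    using psd_kernel_sym[OF assms] by auto
next
  fix n :: nat and x :: "nat \<Rightarrow> 'x \<times> 'i" and c :: "nat \<Rightarrow> real"
  define A where "A = snd ` x ` {..<n}"
  define d where "d p i = (if snd (x i) = p then c i else 0)" for p i
  have "c i * c j * (if snd (x i) = snd (x j) then K (snd (x i)) (fst (x i)) (fst (x j)) else 0)
      = (\<Sum>p\<in>A. d p i * d p j * K p (fst (x i)) (fst (x j)))" if "i < n" for i j
  proof -
    have "snd (x i) \<in> A" "finite A" using that by (auto simp: A_def)
    then have "(\<Sum>p\<in>A. if p = snd (x i) then c i * d p j * K p (fst (x i)) (fst (x j)) else 0)
        = c i * d (snd (x i)) j * K (snd (x i)) (fst (x i)) (fst (x j))"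
      by simp
    moreover have "(\<Sum>p\<in>A. d p i * d p j * K p (fst (x i)) (fst (x j)))
        = (\<Sum>p\<in>A. if p = snd (x i) then c i * d p j * K p (fst (x i)) (fst (x j)) else 0)"
      by (intro sum.cong) (auto simp: d_def)
    ultimately show ?thesis by (auto simp: d_def)
  qed
  then have "(\<Sum>i<n. \<Sum>j<n. c i * c j *
        (if snd (x i) = snd (x j) then K (snd (x i)) (fst (x i)) (fst (x j)) else 0))
      = (\<Sum>i<n. \<Sum>j<n. \<Sum>p\<in>A. d p i * d p j * K p (fst (x i)) (fst (x j)))"
    by (intro sum.cong refl) simp
  also have "\<dots> = (\<Sum>i<n. \<Sum>p\<in>A. \<Sum>j<n. d p i * d p j * K p (fst (x i)) (fst (x j)))"
    by (rule sum.cong[OF refl], rule sum.swap)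
  also have "\<dots> = (\<Sum>p\<in>A. \<Sum>i<n. \<Sum>j<n. d p i * d p j * K p (fst (x i)) (fst (x j)))"
    by (rule sum.swap)
  also have "0 \<le> \<dots>" by (rule sum_nonneg) (rule psd_kernel_nonneg[OF assms])
  finally show "0 \<le> (\<Sum>i<n. \<Sum>j<n. c i * c j *
        (if snd (x i) = snd (x j) then K (snd (x i)) (fst (x i)) (fst (x j)) else 0))" .
qed

section \<open>Kernels as Gram matrices\<close>

text \<open>The rows of the Cholesky factor are finitely supported, so they are vectors of
  \<open>ell2\<close>.\<close>

lemma psd_kernel_nat_gram:
  fixes K :: "nat \<Rightarrow> nat \<Rightarrow> real"
  assumes "psd_kernel K"
  shows "\<exists>v :: nat \<Rightarrow> ell2. \<forall>i j. v i \<bullet> v j = K i j"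
proof -
  obtain L :: "nat \<Rightarrow> nat \<Rightarrow> real"
    where L0: "\<And>i l. i < l \<Longrightarrow> L i l = 0"
      and L: "\<And>i j N. i < N \<Longrightarrow> j < N \<Longrightarrow> K i j = (\<Sum>l<N. L i l * L j l)"
    using cholesky[OF assms] by metis
  have "square_summable (L i)" for i
    unfolding square_summable_def
    by (rule summable_finite[of "{..i}"]) (auto intro: L0)
  then have coord: "coord (Abs_ell2 (L i)) = L i" for i
    by (simp add: Abs_ell2_inverse)
  have "Abs_ell2 (L i) \<bullet> Abs_ell2 (L j) = K i j" for i j
  proof -
    define N where "N = Suc (max i j)"
    have "(\<Sum>l. L i l * L j l) = (\<Sum>l<N. L i l * L j l)"
      by (rule suminf_finite) (auto simp: N_def L0)
    then show ?thesis using L[of i N j] by (simp add: inner_ell2_def coord N_def)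
  qed
  then show ?thesis by (intro exI[of _ "\<lambda>i. Abs_ell2 (L i)"]) simp
qed

lemma dist_gram_square: "(dist (x::'a::real_inner) y)\<^sup>2 = x \<bullet> x - 2 * (x \<bullet> y) + y \<bullet> y"
  by (simp add: dist_norm power2_norm_eq_inner inner_diff_left inner_diff_right inner_commute)

text \<open>Gram vectors over a dense sequence \<open>q\<close> come from the countable case. Their
  squared distances are \<open>K x x - 2 * K x y + K y y\<close>, so joint continuity of
  \<open>K\<close> makes them Cauchy along any sequence that approximates \<open>x\<close>, and
  \<open>F x\<close> is the limit.\<close>

theorem continuous_psd_kernel_gram:
  fixes K :: "'x::second_countable_topology \<Rightarrow> 'x \<Rightarrow> real"
  assumes psd: "psd_kernel K"
    and cont: "\<And>u v x y. u \<longlonglongrightarrow> x \<Longrightarrow> v \<longlonglongrightarrow> y \<Longrightarrow> (\<lambda>k. K (u k) (v k)) \<longlonglongrightarrow> K x y"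
  shows "\<exists>F :: 'x \<Rightarrow> ell2. \<forall>x y. F x \<bullet> F y = K x y"
proof -
  obtain D :: "'x set" where D: "countable D" "\<And>X. open X \<Longrightarrow> X \<noteq> {} \<Longrightarrow> \<exists>d\<in>D. d \<in> X"
    using countable_dense_exists by blast
  have "D \<noteq> {}" using D(2)[of UNIV] by auto
  then have range: "range (from_nat_into D) = D" using D(1) by (rule range_from_nat_into)
  define q where "q = from_nat_into D"
  have "\<exists>r. (\<lambda>k. q (r k)) \<longlonglongrightarrow> x" for x
  proof -
    have "x \<in> closure D"
      using D(2) by (auto simp: closure_iff_nhds_not_empty)
    then obtain u where u: "\<And>k. u k \<in> D" "u \<longlonglongrightarrow> x"
      by (auto simp: closure_sequential)
    then have "\<forall>k. \<exists>i. q i = u k" using range by (metis q_def imageE)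
    then obtain r where "\<forall>k. q (r k) = u k" by metis
    then show ?thesis using u(2) by (intro exI[of _ r]) simp
  qed
  then obtain r where r: "\<And>x. (\<lambda>k. q (r x k)) \<longlonglongrightarrow> x" by metis
  obtain v :: "nat \<Rightarrow> ell2" where v: "\<And>i j. v i \<bullet> v j = K (q i) (q j)"
    using psd_kernel_nat_gram[OF psd_kernel_reindex[OF psd, of q]] by blast
  have "Cauchy (\<lambda>k. v (r x k))" for x
  proof (rule ccontr)
    assume "\<not> Cauchy (\<lambda>k. v (r x k))"
    then obtain e where e: "e > 0"
      and "\<forall>M. \<exists>m\<ge>M. \<exists>n\<ge>M. e \<le> dist (v (r x m)) (v (r x n))"
      unfolding Cauchy_def by (metis not_less)
    \<comment> \<open>Indices that violate the Cauchy condition. Both tend to infinity, so both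
      sequences of points converge to the same \<open>x\<close>.\<close>
    then obtain f g where fg: "\<And>M. M \<le> f M" "\<And>M. M \<le> g M"
      "\<And>M. e \<le> dist (v (r x (f M))) (v (r x (g M)))" by metis
    have lim: "filterlim f sequentially sequentially" "filterlim g sequentially sequentially"
      using fg by (auto intro!: filterlim_at_top_mono[OF filterlim_ident])
    have "(\<lambda>M. (dist (v (r x (f M))) (v (r x (g M))))\<^sup>2) \<longlonglongrightarrow> K x x - 2 * K x x + K x x"
      unfolding dist_gram_square v
      by (intro tendsto_intros cont filterlim_compose[OF r] lim)
    then have "(\<lambda>M. (dist (v (r x (f M))) (v (r x (g M))))\<^sup>2) \<longlonglongrightarrow> 0" by simp
    then have "e\<^sup>2 \<le> 0"
      by (rule LIMSEQ_le_const) (use fg(3) e in \<open>auto intro!: power_mono\<close>)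
    then show False using e by simp
  qed
  then have "\<forall>x. \<exists>l. (\<lambda>k. v (r x k)) \<longlonglongrightarrow> l"
    by (simp add: Cauchy_convergent_iff convergent_def)
  from choice[OF this] obtain F where F: "\<And>x. (\<lambda>k. v (r x k)) \<longlonglongrightarrow> F x" by blast
  have "F x \<bullet> F y = K x y" for x y
  proof (rule LIMSEQ_unique)
    show "(\<lambda>k. v (r x k) \<bullet> v (r y k)) \<longlonglongrightarrow> F x \<bullet> F y" by (intro tendsto_intros F)
    show "(\<lambda>k. v (r x k) \<bullet> v (r y k)) \<longlonglongrightarrow> K x y" unfolding v by (rule cont[OF r r])
  qed
  then show ?thesis by blast
qed

section \<open>Orthogonal representations from invariant families of vectors\<close>

lemma subspace_closure:
  fixes V :: "'a::real_normed_vector set"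
  assumes "subspace V"
  shows "subspace (closure V)"
proof (rule subspaceI)
  show "0 \<in> closure V" using subspace_0[OF assms] closure_subset by blast
next
  fix x y assume "x \<in> closure V" "y \<in> closure V"
  then obtain u v where "\<forall>n. u n \<in> V" "\<forall>n. v n \<in> V" "u \<longlonglongrightarrow> x" "v \<longlonglongrightarrow> y"
    by (auto simp: closure_sequential)
  then have "\<forall>n. u n + v n \<in> V" "(\<lambda>n. u n + v n) \<longlonglongrightarrow> x + y"
    by (auto intro: subspace_add[OF assms] tendsto_add)
  then show "x + y \<in> closure V" unfolding closure_sequential by (intro exI[of _ "\<lambda>n. u n + v n"]) simp
next
  fix a :: real and x assume "x \<in> closure V"
  then obtain u where "\<forall>n. u n \<in> V" "u \<longlonglongrightarrow> x" by (auto simp: closure_sequential)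
  then have "\<forall>n. a *\<^sub>R u n \<in> V" "(\<lambda>n. a *\<^sub>R u n) \<longlonglongrightarrow> a *\<^sub>R x"
    by (auto intro: subspace_scale[OF assms] tendsto_scaleR)
  then show "a *\<^sub>R x \<in> closure V" unfolding closure_sequential by (intro exI[of _ "\<lambda>n. a *\<^sub>R u n"]) simp
qed

lemma closure_span_subset:
  fixes S :: "'a::real_normed_vector set"
  assumes "S \<subseteq> V" "subspace V" "closed V"
  shows "closure (span S) \<subseteq> V"
  using assms by (intro closure_minimal span_minimal)

text \<open>\<open>u - v\<close> is orthogonal to \<open>S\<close>, hence to the closed span, hence
  to itself.\<close>

lemma inner_determines_in_closure_span:
  fixes S :: "'a::real_inner set"
  assumes "u \<in> closure (span S)" "v \<in> closure (span S)" "\<And>s. s \<in> S \<Longrightarrow> u \<bullet> s = v \<bullet> s"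
  shows "u = v"
proof -
  have "closure (span S) \<subseteq> {w. (u - v) \<bullet> w = 0}"
    using assms(3)
    by (intro closure_span_subset closed_Collect_eq subspaceI)
       (auto simp: inner_diff_left inner_add_right intro!: continuous_intros)
  moreover have "u - v \<in> closure (span S)"
    by (intro subspace_diff subspace_closure subspace_span assms)
  ultimately show ?thesis by auto
qed

text \<open>
  The extension is obtained as the closed subspace of the product spanned by the pairs
  \<open>(F x, F' x)\<close>, which is the graph of an isometry.
\<close>

lemma gram_extension:
  fixes F F' :: "'x \<Rightarrow> 'a::{real_inner, banach}"
  assumes gram: "\<And>x y. F' x \<bullet> F' y = F x \<bullet> F y"
  shows "\<exists>U. (\<forall>x. U (F x) = F' x) \<and>
           (\<forall>u\<in>closure (span (range F)). U u \<in> closure (span (range F'))) \<and>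
           (\<forall>u\<in>closure (span (range F)). \<forall>v\<in>closure (span (range F)). U u \<bullet> U v = u \<bullet> v)"
proof -
  define G where "G = range (\<lambda>x. (F x, F' x))"
  define R where "R = closure (span G)"
  have subspace_R: "subspace R" and closed_R: "closed R"
    by (auto simp: R_def intro: subspace_closure)
  have G_R: "(F x, F' x) \<in> R" for x
    unfolding R_def using closure_subset span_superset by (force simp: G_def)
  have closed_form: "closed {p. fst p \<bullet> a = snd p \<bullet> b}" "subspace {p. fst p \<bullet> a = snd p \<bullet> b}"
    for a b :: 'a
    by (auto intro!: closed_Collect_eq continuous_intros subspaceI simp: inner_add_left)
  \<comment> \<open>The identity is bilinear, so it is extended from \<open>G\<close> to
    \<open>R\<close> in one argument at a time.\<close>
  have "R \<subseteq> {p. fst p \<bullet> F x = snd p \<bullet> F' x}" for x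
    unfolding R_def by (rule closure_span_subset[OF _ closed_form(2,1)]) (auto simp: G_def gram)
  then have "G \<subseteq> {q. fst q \<bullet> fst p = snd q \<bullet> snd p}" if "p \<in> R" for p
    using that by (fastforce simp: G_def inner_commute)
  then have "R \<subseteq> {q. fst q \<bullet> fst p = snd q \<bullet> snd p}" if "p \<in> R" for p
    unfolding R_def using that by (intro closure_span_subset closed_form) (auto simp: R_def)
  then have inner_R: "u \<bullet> u' = w \<bullet> w'" if "(u, w) \<in> R" "(u', w') \<in> R" for u w u' w'
    using that by force
  \<comment> \<open>Both components of an element of \<open>R\<close> have the same norm. The
    projection is therefore bounded below, by 1/2 because of the triangle inequality for pairs, and
    has closed image; so the isometry is defined on the whole closed span.\<close>
  have "complete (fst ` R)"
  proof (rule complete_isometric_image[of "1/2"])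
    show "\<forall>p\<in>R. 1/2 * norm p \<le> norm (fst p)"
    proof
      fix p assume "p \<in> R"
      then have "norm (fst p) = norm (snd p)"
        using inner_R[of "fst p" "snd p" "fst p" "snd p"] by (simp add: norm_eq)
      then show "1/2 * norm p \<le> norm (fst p)"
        using norm_Pair_le[of "fst p" "snd p"] by simp
    qed
  qed (auto simp: subspace_R closed_R complete_eq_closed bounded_linear_fst)
  then have "closed (fst ` R)" by (rule complete_imp_closed)
  moreover have "subspace (fst ` R)"
    using subspace_R by (intro linear_subspace_image bounded_linear.linear[OF bounded_linear_fst])
  moreover have "range F \<subseteq> fst ` R" using G_R by force
  ultimately have "closure (span (range F)) \<subseteq> fst ` R"
    by (intro closure_span_subset)
  then have "\<forall>u\<in>closure (span (range F)). \<exists>w. (u, w) \<in> R" by force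
  then obtain U where U: "\<And>u. u \<in> closure (span (range F)) \<Longrightarrow> (u, U u) \<in> R" by metis
  \<comment> \<open>\<open>R\<close> is single-valued: the second component of
    \<open>(0, w - w')\<close> has the norm of 0. This yields \<open>U (F x) = F' x\<close>.\<close>
  have unique: "w = w'" if "(u, w) \<in> R" "(u, w') \<in> R" for u w w'
  proof -
    have "(0, w - w') \<in> R" using subspace_diff[OF subspace_R that] by simp
    from inner_R[OF this this] show ?thesis by simp
  qed
  have range_U: "w \<in> closure (span (range F'))" if "(u, w) \<in> R" for u w
  proof -
    have "R \<subseteq> snd -` closure (span (range F'))"
      unfolding R_def
    proof (rule closure_span_subset)
      show "G \<subseteq> snd -` closure (span (range F'))"
        using closure_subset span_superset by (force simp: G_def)
      show "subspace (snd -` closure (span (range F')))"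
        using subspace_closure[OF subspace_span[of "range F'"]]
        by (auto intro!: subspaceI simp: subspace_0 subspace_add subspace_scale)
      show "closed (snd -` closure (span (range F')))"
        by (rule closed_vimage_snd) simp
    qed
    then show ?thesis using that by auto
  qed
  have "F x \<in> closure (span (range F))" for x
    using closure_subset span_superset by (metis in_mono rangeI)
  then show ?thesis
    using U inner_R range_U unique[OF U G_R] by (intro exI[of _ U]) (auto simp: inner_R[symmetric])
qed

text \<open>The squared norm of the defect expands into inner products, which \<open>U\<close>
  preserves; it equals that of the zero vector.\<close>

lemma inner_preserving_linear_combination:
  fixes U :: "'a::real_inner \<Rightarrow> 'b::real_inner"
  assumes "subspace M" and inner: "\<And>u v. u \<in> M \<Longrightarrow> v \<in> M \<Longrightarrow> U u \<bullet> U v = u \<bullet> v"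
    and "u \<in> M" "v \<in> M"
  shows "U (a *\<^sub>R u + b *\<^sub>R v) = a *\<^sub>R U u + b *\<^sub>R U v"
proof -
  define w where "w = a *\<^sub>R u + b *\<^sub>R v"
  have w: "w \<in> M" unfolding w_def by (intro subspace_add subspace_scale assms)
  have "(U w - (a *\<^sub>R U u + b *\<^sub>R U v)) \<bullet> (U w - (a *\<^sub>R U u + b *\<^sub>R U v))
      = (w - (a *\<^sub>R u + b *\<^sub>R v)) \<bullet> (w - (a *\<^sub>R u + b *\<^sub>R v))"
    using w assms(3,4) by (simp add: inner_diff_left inner_diff_right inner_add_left inner_add_right inner)
  then show ?thesis by (simp add: w_def)
qed

text \<open>\<open>F g i\<close> is thought of as the translate by \<open>g\<close> of the vector
  \<open>F 0 i\<close>. Invariance of the Gram matrix is what makes left translation extend to an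
  orthogonal representation \<open>U\<close> on the closed span \<open>M\<close>.\<close>

locale invariant_family =
  fixes F :: "'g::topological_group_add \<Rightarrow> 'i \<Rightarrow> 'a::{real_inner, banach}"
  assumes gram_invariant: "F (a + g) i \<bullet> F (a + h) j = F g i \<bullet> F h j"
    and continuous_F: "continuous_on UNIV (\<lambda>g. F g i)"
begin

definition M :: "'a set" where
  "M = closure (span (range (\<lambda>(h, i). F h i)))"

text \<open>The choice leaves \<open>U g\<close> unspecified outside \<open>M\<close>, whence the
  membership premises of all laws below.\<close>

definition U :: "'g \<Rightarrow> 'a \<Rightarrow> 'a" where
  "U g = (SOME U. (\<forall>h i. U (F h i) = F (g + h) i) \<and> (\<forall>u\<in>M. U u \<in> M) \<and>
                  (\<forall>u\<in>M. \<forall>v\<in>M. U u \<bullet> U v = u \<bullet> v))"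

lemma subspace_M: "subspace M" and closed_M: "closed M"
  by (auto simp: M_def intro: subspace_closure)

lemma F_in_M: "F h i \<in> M"
proof -
  have "F h i \<in> range (\<lambda>(h, i). F h i)" by (rule range_eqI[of _ _ "(h, i)"]) simp
  then show ?thesis unfolding M_def by (intro subsetD[OF closure_subset] span_base)
qed

lemma M_eqI:
  assumes "u \<in> M" "v \<in> M" "\<And>h i. u \<bullet> F h i = v \<bullet> F h i"
  shows "u = v"
  using assms unfolding M_def by (auto intro: inner_determines_in_closure_span)

lemma M_subset:
  assumes "subspace V" "closed V" "\<And>h i. F h i \<in> V"
  shows "M \<subseteq> V"
  unfolding M_def using assms by (intro closure_span_subset) auto

lemma U_F: "U g (F h i) = F (g + h) i"
  and U_in_M: "u \<in> M \<Longrightarrow> U g u \<in> M"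
  and U_inner: "u \<in> M \<Longrightarrow> v \<in> M \<Longrightarrow> U g u \<bullet> U g v = u \<bullet> v"
proof -
  \<comment> \<open>The translated family is the old one reindexed by the bijection
    \<open>h \<mapsto> g + h\<close>, so the target of the isometry is again
    \<open>M\<close>.\<close>
  have range: "range (\<lambda>(h, i). F (g + h) i) = range (\<lambda>(h, i). F h i)"
  proof
    show "range (\<lambda>(h, i). F h i) \<subseteq> range (\<lambda>(h, i). F (g + h) i)"
    proof clarify
      fix h i show "F h i \<in> range (\<lambda>(h, i). F (g + h) i)"
        by (rule range_eqI[of _ _ "(- g + h, i)"]) (simp add: add.assoc[symmetric])
    qed
  qed force
  have "\<exists>U. (\<forall>h i. U (F h i) = F (g + h) i) \<and> (\<forall>u\<in>M. U u \<in> M) \<and>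
          (\<forall>u\<in>M. \<forall>v\<in>M. U u \<bullet> U v = u \<bullet> v)"
    using gram_extension[of "\<lambda>(h, i). F (g + h) i" "\<lambda>(h, i). F h i"]
    unfolding range M_def[symmetric] by (auto simp: gram_invariant)
  from someI_ex[OF this, folded U_def]
  show "U g (F h i) = F (g + h) i" "u \<in> M \<Longrightarrow> U g u \<in> M"
    "u \<in> M \<Longrightarrow> v \<in> M \<Longrightarrow> U g u \<bullet> U g v = u \<bullet> v"
    by auto
qed

lemma U_linear: "u \<in> M \<Longrightarrow> v \<in> M \<Longrightarrow> U g (a *\<^sub>R u + b *\<^sub>R v) = a *\<^sub>R U g u + b *\<^sub>R U g v"
  by (rule inner_preserving_linear_combination[OF subspace_M U_inner])

lemma U_plus: "u \<in> M \<Longrightarrow> v \<in> M \<Longrightarrow> U g (u + v) = U g u + U g v"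
  using U_linear[of u v g 1 1] by simp

lemma U_minus: "u \<in> M \<Longrightarrow> v \<in> M \<Longrightarrow> U g (u - v) = U g u - U g v"
  using U_linear[of u v g 1 "-1"] by simp

lemma U_scaleR: "u \<in> M \<Longrightarrow> U g (a *\<^sub>R u) = a *\<^sub>R U g u"
  using U_linear[of u u g a 0] by simp

lemma U_norm: "u \<in> M \<Longrightarrow> norm (U g u) = norm u"
  by (simp add: norm_eq U_inner)

lemma U_dist: "u \<in> M \<Longrightarrow> v \<in> M \<Longrightarrow> dist (U g u) (U g v) = dist u v"
  by (metis U_minus U_norm dist_norm subspace_M subspace_diff)

lemma U_inner_F: "u \<in> M \<Longrightarrow> U g u \<bullet> F (g + h) i = u \<bullet> F h i"
  using U_inner[of u "F h i" g] by (simp add: F_in_M U_F)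

text \<open>Elements of \<open>M\<close> are determined by their inner products with the vectors
  \<open>F k i\<close>, and there each application of \<open>U\<close> is undone by translating the
  index \<open>k\<close>.\<close>

lemma U_add:
  assumes "u \<in> M"
  shows "U (g + h) u = U g (U h u)"
proof (rule M_eqI)
  fix k i
  have k: "k = (g + h) + (- (g + h) + k)" by (simp add: add.assoc[symmetric])
  have "U (g + h) u \<bullet> F k i = u \<bullet> F (- (g + h) + k) i"
    by (subst k) (rule U_inner_F[OF assms])
  moreover have "U g (U h u) \<bullet> F k i = u \<bullet> F (- (g + h) + k) i"
    using U_inner_F[OF U_in_M[OF assms], of g h "h + (- (g + h) + k)" i]
      U_inner_F[OF assms, of h "- (g + h) + k" i]
    by (subst k) (simp only: add.assoc)
  ultimately show "U (g + h) u \<bullet> F k i = U g (U h u) \<bullet> F k i" by simp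
qed (simp_all add: U_in_M assms)

lemma U_0: "u \<in> M \<Longrightarrow> U 0 u = u"
  by (rule M_eqI) (use U_inner_F[of u 0] in \<open>auto simp: U_in_M\<close>)

text \<open>The vectors with continuous orbit maps form a subspace that contains every
  \<open>F h i\<close>. It is closed because the \<open>U g\<close> are isometries, so that
  convergence of vectors is uniform convergence of orbit maps.\<close>

lemma continuous_U:
  assumes "u \<in> M"
  shows "continuous_on UNIV (\<lambda>g. U g u)"
proof -
  define V where "V = {u \<in> M. continuous_on UNIV (\<lambda>g. U g u)}"
  have "M \<subseteq> V"
  proof (rule M_subset)
    show "subspace V"
    proof (rule subspaceI)
      have "U g 0 = 0" for g
        using U_norm[OF subspace_0[OF subspace_M], of g] by simp
      then show "0 \<in> V" using subspace_0[OF subspace_M] by (simp add: V_def)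
    qed (auto simp: V_def U_plus U_scaleR intro: subspace_add[OF subspace_M]
           subspace_scale[OF subspace_M] continuous_on_add continuous_on_scaleR continuous_on_const)
    show "closed V"
      unfolding closed_sequential_limits
    proof (intro allI impI, elim conjE)
      fix v l assume v: "\<forall>n. v n \<in> V" "v \<longlonglongrightarrow> l"
      then have "l \<in> M"
        using closed_M by (auto simp: V_def closed_sequential_limits)
      have "continuous_on UNIV (\<lambda>g. U g l)"
      proof (rule uniform_limit_theorem[OF _ _ trivial_limit_sequentially])
        show "\<forall>\<^sub>F n in sequentially. continuous_on UNIV (\<lambda>g. U g (v n))"
          using v(1) by (simp add: V_def)
        show "uniform_limit UNIV (\<lambda>n g. U g (v n)) (\<lambda>g. U g l) sequentially"
        proof (rule uniform_limitI)
          fix e :: real assume "0 < e"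
          from tendstoD[OF v(2) this]
          show "\<forall>\<^sub>F n in sequentially. \<forall>g\<in>UNIV. dist (U g (v n)) (U g l) < e"
            using v(1) \<open>l \<in> M\<close> by (simp add: V_def U_dist)
        qed
      qed
      then show "l \<in> V" using \<open>l \<in> M\<close> by (simp add: V_def)
    qed
    show "F h i \<in> V" for h i
    proof -
      have "continuous_on UNIV (\<lambda>g. F (g + h) i)"
        by (rule continuous_on_compose2[OF continuous_F]) (auto simp: continuous_on_def intro!: tendsto_intros)
      then show ?thesis by (simp add: V_def F_in_M U_F)
    qed
  qed
  then show ?thesis using assms by (auto simp: V_def)
qed

end

text \<open>All kernels are realised together by the block kernel on \<open>'g \<times> nat\<close>.
  Continuity of each \<open>g \<mapsto> F g n\<close> follows from the expression of squared
  distances by \<open>K n\<close>.\<close>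

lemma psd_kernels_gram_family:
  fixes K :: "nat \<Rightarrow> 'g::{polish_space, topological_group_add} \<Rightarrow> 'g \<Rightarrow> real"
  assumes psd: "\<And>n. psd_kernel (K n)"
    and cont: "\<And>n u v x y. u \<longlonglongrightarrow> x \<Longrightarrow> v \<longlonglongrightarrow> y \<Longrightarrow> (\<lambda>k. K n (u k) (v k)) \<longlonglongrightarrow> K n x y"
    and inv: "\<And>n a g h. K n (a + g) (a + h) = K n g h"
  shows "\<exists>F :: 'g \<Rightarrow> nat \<Rightarrow> ell2. invariant_family F \<and>
           (\<forall>g h n m. F g n \<bullet> F h m = (if n = m then K n g h else 0))"
proof -
  define L where "L p q = (if snd p = snd q then K (snd p) (fst p) (fst q) else 0)"
    for p q :: "'g \<times> nat"
  have "psd_kernel L"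
    unfolding L_def by (rule psd_kernel_block[OF psd])
  moreover have L_cont: "(\<lambda>k. L (u k) (v k)) \<longlonglongrightarrow> L x y" if "u \<longlonglongrightarrow> x" "v \<longlonglongrightarrow> y" for u v x y
  proof -
    \<comment> \<open>\<open>nat\<close> is discrete, so convergent pairs eventually stay in the
      block of their limit.\<close>
    have "\<forall>\<^sub>F k in sequentially. snd (u k) = snd x" "\<forall>\<^sub>F k in sequentially. snd (v k) = snd y"
      using tendsto_snd[OF that(1)] tendsto_snd[OF that(2)] by (auto simp: tendsto_discrete)
    then have "\<forall>\<^sub>F k in sequentially. (if snd x = snd y then K (snd x) (fst (u k)) (fst (v k)) else 0)
        = L (u k) (v k)"
      by eventually_elim (simp add: L_def)
    moreover have "(\<lambda>k. if snd x = snd y then K (snd x) (fst (u k)) (fst (v k)) else 0) \<longlonglongrightarrow> L x y"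
      unfolding L_def using cont[OF tendsto_fst[OF that(1)] tendsto_fst[OF that(2)]] by simp
    ultimately show ?thesis by (rule Lim_transform_eventually[rotated])
  qed
  ultimately obtain F' :: "'g \<times> nat \<Rightarrow> ell2" where F': "\<And>x y. F' x \<bullet> F' y = L x y"
    using continuous_psd_kernel_gram[of L] by metis
  define F where "F g n = F' (g, n)" for g n
  have gram: "F g n \<bullet> F h m = (if n = m then K n g h else 0)" for g h n m
    by (simp add: F_def F' L_def)
  have "invariant_family F"
  proof
    show "F (a + g) i \<bullet> F (a + h) j = F g i \<bullet> F h j" for a g h i j
      by (simp add: gram inv)
    show "continuous_on UNIV (\<lambda>g. F g i)" for i
      unfolding continuous_on_sequentially
    proof (intro allI ballI impI, elim conjE)
      fix u :: "nat \<Rightarrow> 'g" and a assume u: "u \<longlonglongrightarrow> a"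
      have "(\<lambda>k. (dist (F (u k) i) (F a i))\<^sup>2) \<longlonglongrightarrow> K i a a - 2 * K i a a + K i a a"
        unfolding dist_gram_square gram by (simp only: simp_thms if_True) (intro tendsto_intros cont u)
      then have "(\<lambda>k. sqrt ((dist (F (u k) i) (F a i))\<^sup>2)) \<longlonglongrightarrow> sqrt 0"
        by (intro tendsto_real_sqrt) simp
      then show "((\<lambda>g. F g i) \<circ> u) \<longlonglongrightarrow> F a i"
        by (simp add: o_def tendsto_dist_iff[symmetric])
    qed
  qed
  then show ?thesis using gram by blast
qed

section \<open>Circumcentres\<close>

text \<open>
  The Bruhat--Tits fixed point theorem. The sequence of almost optimal centres is Cauchy by the
  CN inequality for midpoints.
\<close>

lemma (in Metric_space) circumcentre_fixed:
  assumes "mcomplete"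
    and CN: "\<And>x y. x \<in> M \<Longrightarrow> y \<in> M \<Longrightarrow>
          \<exists>m\<in>M. \<forall>z\<in>M. (d z m)\<^sup>2 \<le> ((d z x)\<^sup>2 + (d z y)\<^sup>2) / 2 - (d x y)\<^sup>2 / 4"
    and B: "B \<subseteq> M" "B \<noteq> {}"
    and p0: "p0 \<in> M" "\<And>z. z \<in> B \<Longrightarrow> d z p0 \<le> r0"
  shows "\<exists>c\<in>M. (\<forall>z\<in>B. d z c \<le> r0) \<and>
           (\<forall>f. (\<forall>x\<in>M. f x \<in> M) \<and> (\<forall>x\<in>M. \<forall>y\<in>M. d (f x) (f y) = d x y) \<and> B \<subseteq> f ` B \<longrightarrow> f c = c)"
proof -
  define S where "S = {r. \<exists>p\<in>M. \<forall>z\<in>B. (d z p)\<^sup>2 \<le> r}"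
  define \<rho> where "\<rho> = Inf S"
  have S_nonneg: "0 \<le> r" if "r \<in> S" for r
    using that B(2) unfolding S_def by (auto intro: order_trans[OF zero_le_power2])
  then have bdd: "bdd_below S" by (meson bdd_belowI)
  have r0: "(d z p0)\<^sup>2 \<le> r0\<^sup>2" if "z \<in> B" for z
    using p0(2)[OF that] by (simp add: power_mono)
  then have "r0\<^sup>2 \<in> S" unfolding S_def using p0(1) by blast
  \<comment> \<open>If \<open>p\<close> and \<open>q\<close> both have squared radius at most
    \<open>\<rho> + e\<close>, then their midpoint has squared radius at most
    \<open>\<rho> + e - (d p q)^2 / 4\<close>, which cannot fall below the infimum
    \<open>\<rho>\<close>.\<close>
  have near: "(d p q)\<^sup>2 \<le> 4 * e"
    if pq: "p \<in> M" "q \<in> M" and rad: "\<And>z. z \<in> B \<Longrightarrow> (d z p)\<^sup>2 \<le> \<rho> + e" "\<And>z. z \<in> B \<Longrightarrow> (d z q)\<^sup>2 \<le> \<rho> + e"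
    for p q e
  proof -
    obtain m where m: "m \<in> M"
      "\<And>z. z \<in> M \<Longrightarrow> (d z m)\<^sup>2 \<le> ((d z p)\<^sup>2 + (d z q)\<^sup>2) / 2 - (d p q)\<^sup>2 / 4"
      using CN[OF pq] by blast
    have "(d z m)\<^sup>2 \<le> \<rho> + e - (d p q)\<^sup>2 / 4" if "z \<in> B" for z
    proof -
      have "z \<in> M" using B(1) that by blast
      then show ?thesis using m(2)[of z] rad(1)[OF that] rad(2)[OF that] by argo
    qed
    then have "\<rho> + e - (d p q)\<^sup>2 / 4 \<in> S" unfolding S_def using m(1) by blast
    then have "\<rho> \<le> \<rho> + e - (d p q)\<^sup>2 / 4" unfolding \<rho>_def using bdd by (rule cInf_lower)
    then show ?thesis by simp
  qed
  have "\<exists>p\<in>M. \<forall>z\<in>B. (d z p)\<^sup>2 \<le> \<rho> + inverse (Suc n)" for n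
  proof -
    have "Inf S < \<rho> + inverse (Suc n)" by (simp add: \<rho>_def)
    then obtain r where "r \<in> S" "r < \<rho> + inverse (Suc n)"
      using \<open>r0\<^sup>2 \<in> S\<close> by (metis cInf_lessD empty_iff)
    then obtain p where "p \<in> M" and p: "\<And>z. z \<in> B \<Longrightarrow> (d z p)\<^sup>2 \<le> r" unfolding S_def by blast
    have "(d z p)\<^sup>2 \<le> \<rho> + inverse (Suc n)" if "z \<in> B" for z
      using p[OF that] \<open>r < \<rho> + inverse (Suc n)\<close> by linarith
    then show ?thesis using \<open>p \<in> M\<close> by blast
  qed
  then obtain p where p: "\<And>n. p n \<in> M" "\<And>n z. z \<in> B \<Longrightarrow> (d z (p n))\<^sup>2 \<le> \<rho> + inverse (Suc n)"
    by metis
  have small: "\<exists>N. \<forall>n\<ge>N. inverse (real (Suc n)) < e" if "0 < e" for e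
    using that LIMSEQ_inverse_real_of_nat by (auto dest!: tendstoD[of _ _ _ e] simp: eventually_sequentially)
  have "MCauchy p"
    unfolding MCauchy_def
  proof (intro conjI allI impI)
    fix e :: real assume "0 < e"
    then obtain N where N: "\<And>n. n \<ge> N \<Longrightarrow> inverse (real (Suc n)) < e\<^sup>2 / 4"
      using small[of "e\<^sup>2 / 4"] by auto
    have "d (p n) (p m) < e" if "N \<le> n" "N \<le> m" for n m
    proof -
      define s where "s = max (inverse (real (Suc n))) (inverse (real (Suc m)))"
      have "(d (p n) (p m))\<^sup>2 \<le> 4 * s"
        using p by (intro near) (auto simp: s_def intro: order_trans[OF p(2)])
      also have "\<dots> < e\<^sup>2" using N[OF that(1)] N[OF that(2)] by (simp add: s_def)
      finally show ?thesis using \<open>0 < e\<close> by (simp add: power_less_imp_less_base)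
    qed
    then show "\<exists>N. \<forall>n n'. N \<le> n \<longrightarrow> N \<le> n' \<longrightarrow> d (p n) (p n') < e" by blast
  qed (use p(1) in blast)
  then obtain c where c: "limitin mtopology p c sequentially"
    using \<open>mcomplete\<close> by (auto simp: mcomplete_def)
  then have "c \<in> M" and lim: "\<And>e. 0 < e \<Longrightarrow> \<exists>N. \<forall>n\<ge>N. d (p n) c < e"
    unfolding limit_metric_sequentially by blast+
  have centre: "(d z c)\<^sup>2 \<le> \<rho>" if "z \<in> B" for z
  proof -
    have z: "z \<in> M" using that B(1) by blast
    have "(\<lambda>n. d (p n) c) \<longlonglongrightarrow> 0"
      using lim by (simp add: LIMSEQ_iff)
    moreover have "\<bar>d z (p n) - d z c\<bar> \<le> d (p n) c" for n
      using triangle[OF z p(1) \<open>c \<in> M\<close>, of n] triangle[OF z \<open>c \<in> M\<close> p(1), of n] commute[of c "p n"]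
      by linarith
    ultimately have "(\<lambda>n. d z (p n)) \<longlonglongrightarrow> d z c"
      by (intro LIM_zero_cancel[of _ "d z c"]) (rule Lim_null_comparison, auto)
    then have "(\<lambda>n. (d z (p n))\<^sup>2) \<longlonglongrightarrow> (d z c)\<^sup>2" by (intro tendsto_intros)
    moreover have "(\<lambda>n. \<rho> + inverse (real (Suc n))) \<longlonglongrightarrow> \<rho> + 0"
      by (intro tendsto_add tendsto_const LIMSEQ_inverse_real_of_nat)
    ultimately show ?thesis using p(2)[OF that] by (auto intro: LIMSEQ_le)
  qed
  have "d z c \<le> r0" if "z \<in> B" for z
  proof (rule power2_le_imp_le)
    have "\<rho> \<le> r0\<^sup>2" unfolding \<rho>_def using \<open>r0\<^sup>2 \<in> S\<close> bdd by (rule cInf_lower)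
    then show "(d z c)\<^sup>2 \<le> r0\<^sup>2" using centre[OF that] by simp
    show "0 \<le> r0" using p0(2)[OF that] nonneg[of z p0] by linarith
  qed
  moreover have "f c = c"
    if f: "\<forall>x\<in>M. f x \<in> M" "\<forall>x\<in>M. \<forall>y\<in>M. d (f x) (f y) = d x y" "B \<subseteq> f ` B" for f
  proof -
    \<comment> \<open>\<open>f c\<close> is again an optimal centre, since every point of
      \<open>B\<close> is the image of a point of \<open>B\<close>. Then \<open>near\<close> with
      \<open>e = 0\<close> forces \<open>f c = c\<close>.\<close>
    have "(d z (f c))\<^sup>2 \<le> \<rho>" if "z \<in> B" for z
    proof -
      obtain z' where "z' \<in> B" "z = f z'" using f(3) \<open>z \<in> B\<close> by blast
      then show ?thesis using f(2) B(1) \<open>c \<in> M\<close> centre[of z'] by (metis subsetD)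
    qed
    then have "(d (f c) c)\<^sup>2 \<le> 4 * 0"
      using centre \<open>c \<in> M\<close> f(1) by (intro near) auto
    then show ?thesis using zero[of "f c" c] \<open>c \<in> M\<close> f(1) by simp
  qed
  ultimately show ?thesis using \<open>c \<in> M\<close> by blast
qed

section \<open>Hilbert spaces given by a carrier set\<close>

lemma cring_scalars: "cring (scalars :: 'k::field ring)"
proof (rule cringI)
  show "abelian_group (scalars :: 'k ring)"
    by (rule abelian_groupI) (auto simp: scalars_def algebra_simps intro: exI[of _ "- x" for x])
  show "comm_monoid (scalars :: 'k ring)"
    by (rule comm_monoidI) (auto simp: scalars_def algebra_simps)
qed (auto simp: scalars_def algebra_simps)

locale real_hilbert =
  fixes H :: "(real, 'v) inner_product_space"
  assumes real_hilbert_space: "real_hilbert_space H"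
begin

sublocale Module.module scalars H
  using real_hilbert_space by (simp add: hilbert_space_def)

lemma smult_in_carrier: "x \<in> carrier H \<Longrightarrow> a \<odot>\<^bsub>H\<^esub> x \<in> carrier H"
  using smult_closed[of a x] by (simp add: scalars_def)

lemma ip_sym: "x \<in> carrier H \<Longrightarrow> y \<in> carrier H \<Longrightarrow> ip H x y = ip H y x"
  and ip_add: "x \<in> carrier H \<Longrightarrow> y \<in> carrier H \<Longrightarrow> z \<in> carrier H \<Longrightarrow>
        ip H (x \<oplus>\<^bsub>H\<^esub> y) z = ip H x z + ip H y z"
  and ip_smult: "x \<in> carrier H \<Longrightarrow> y \<in> carrier H \<Longrightarrow> ip H (a \<odot>\<^bsub>H\<^esub> x) y = a * ip H x y"
  and ip_eq_0: "x \<in> carrier H \<Longrightarrow> ip H x x = 0 \<Longrightarrow> x = \<zero>\<^bsub>H\<^esub>"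
  and mcomplete_carrier: "Metric_space.mcomplete (carrier H) (hdist H)"
  using real_hilbert_space unfolding hilbert_space_def by blast+

lemma ip_nonneg: "x \<in> carrier H \<Longrightarrow> 0 \<le> ip H x x"
  using real_hilbert_space unfolding hilbert_space_def
  by (metis nonneg_Reals_of_real_iff of_real_eq_id id_apply)

lemma ip_add_right: "x \<in> carrier H \<Longrightarrow> y \<in> carrier H \<Longrightarrow> z \<in> carrier H \<Longrightarrow>
    ip H z (x \<oplus>\<^bsub>H\<^esub> y) = ip H z x + ip H z y"
  by (metis ip_add ip_sym M.a_closed)

lemma ip_smult_right: "x \<in> carrier H \<Longrightarrow> y \<in> carrier H \<Longrightarrow> ip H y (a \<odot>\<^bsub>H\<^esub> x) = a * ip H y x"
  by (metis ip_smult ip_sym smult_in_carrier)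

lemma ip_zero: "y \<in> carrier H \<Longrightarrow> ip H \<zero>\<^bsub>H\<^esub> y = 0"
  using ip_add[of "\<zero>\<^bsub>H\<^esub>" "\<zero>\<^bsub>H\<^esub>" y] by simp

lemma ip_uminus: "x \<in> carrier H \<Longrightarrow> y \<in> carrier H \<Longrightarrow> ip H (\<ominus>\<^bsub>H\<^esub> x) y = - ip H x y"
  using ip_add[of x "\<ominus>\<^bsub>H\<^esub> x" y] by (simp add: M.r_neg ip_zero)

lemma ip_diff: "x \<in> carrier H \<Longrightarrow> y \<in> carrier H \<Longrightarrow> z \<in> carrier H \<Longrightarrow>
    ip H (x \<ominus>\<^bsub>H\<^esub> y) z = ip H x z - ip H y z"
  by (simp add: a_minus_def ip_add ip_uminus)

lemma ip_diff_right: "x \<in> carrier H \<Longrightarrow> y \<in> carrier H \<Longrightarrow> z \<in> carrier H \<Longrightarrow>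
    ip H z (x \<ominus>\<^bsub>H\<^esub> y) = ip H z x - ip H z y"
  by (metis ip_diff ip_sym M.minus_closed)

lemmas ip_simps = ip_add ip_add_right ip_diff ip_diff_right ip_smult ip_smult_right

lemma cauchy_schwarz:
  assumes x: "x \<in> carrier H" and y: "y \<in> carrier H"
  shows "(ip H x y)\<^sup>2 \<le> ip H x x * ip H y y"
proof (cases "ip H y y = 0")
  case True
  then have "ip H x y = 0" using ip_eq_0[OF y True] ip_zero[OF x] ip_sym[OF x y] by simp
  then show ?thesis using ip_nonneg[OF x] True by simp
next
  case False
  then have pos: "0 < ip H y y" using ip_nonneg[OF y] by simp
  define a where "a = - ip H x y / ip H y y"
  have "0 \<le> ip H (x \<oplus>\<^bsub>H\<^esub> a \<odot>\<^bsub>H\<^esub> y) (x \<oplus>\<^bsub>H\<^esub> a \<odot>\<^bsub>H\<^esub> y)"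
    by (intro ip_nonneg M.a_closed smult_in_carrier x y)
  also have "\<dots> = ip H x x + 2 * a * ip H x y + a * (a * ip H y y)"
    using ip_sym[OF y x] by (simp add: ip_simps x y smult_in_carrier distrib_left)
  also have "\<dots> = ip H x x - (ip H x y)\<^sup>2 / ip H y y"
    using False by (simp add: a_def power2_eq_square)
  finally show ?thesis using pos by (simp add: pos_divide_le_eq)
qed

lemma hnorm_square: "x \<in> carrier H \<Longrightarrow> (hnorm H x)\<^sup>2 = ip H x x"
  using ip_nonneg by (simp add: hnorm_def)

lemma hnorm_nonneg: "0 \<le> hnorm H x"
  by (simp add: hnorm_def)

lemma hdist_square:
  assumes "x \<in> carrier H" "y \<in> carrier H"
  shows "(hdist H x y)\<^sup>2 = ip H x x - 2 * ip H x y + ip H y y"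
  using assms ip_sym[OF assms] by (simp add: hdist_def hnorm_square ip_simps)

lemma ip_le_hnorm_mult:
  assumes "x \<in> carrier H" "y \<in> carrier H"
  shows "ip H x y \<le> hnorm H x * hnorm H y"
proof -
  have "(ip H x y)\<^sup>2 \<le> (hnorm H x * hnorm H y)\<^sup>2"
    using cauchy_schwarz[OF assms] by (simp add: power_mult_distrib hnorm_square assms)
  then show ?thesis by (simp add: abs_le_square_iff[symmetric] hnorm_nonneg)
qed

sublocale Metric_space "carrier H" "hdist H"
proof
  show "0 \<le> hdist H x y" for x y by (simp add: hdist_def hnorm_nonneg)
  show "hdist H x y = hdist H y x" for x y
  proof (cases "x \<in> carrier H \<and> y \<in> carrier H")
    case True
    then have "(hdist H x y)\<^sup>2 = (hdist H y x)\<^sup>2" by (simp add: hdist_square ip_sym)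
    then show ?thesis by (simp add: hdist_def hnorm_nonneg power2_eq_iff_nonneg split: if_splits)
  qed (auto simp: hdist_def)
  show "hdist H x y = 0 \<longleftrightarrow> x = y" if "x \<in> carrier H" "y \<in> carrier H" for x y
  proof
    assume "hdist H x y = 0"
    then have "ip H (x \<ominus>\<^bsub>H\<^esub> y) (x \<ominus>\<^bsub>H\<^esub> y) = 0"
      using that hnorm_square[of "x \<ominus>\<^bsub>H\<^esub> y"] by (simp add: hdist_def)
    then have "x \<oplus>\<^bsub>H\<^esub> (\<ominus>\<^bsub>H\<^esub> y) = \<zero>\<^bsub>H\<^esub>"
      using ip_eq_0[of "x \<ominus>\<^bsub>H\<^esub> y"] that by (simp add: a_minus_def)
    then show "x = y" using M.minus_equality[of x "\<ominus>\<^bsub>H\<^esub> y"] that by simp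
  next
    assume "x = y"
    then have "(hdist H x y)\<^sup>2 = 0" using that by (simp add: hdist_square)
    then show "hdist H x y = 0" by simp
  qed
  show "hdist H x z \<le> hdist H x y + hdist H y z"
    if "x \<in> carrier H" "y \<in> carrier H" "z \<in> carrier H" for x y z
  proof (rule power2_le_imp_le)
    have "(hdist H x z)\<^sup>2 = (hdist H x y)\<^sup>2 + 2 * ip H (x \<ominus>\<^bsub>H\<^esub> y) (y \<ominus>\<^bsub>H\<^esub> z) + (hdist H y z)\<^sup>2"
      using that by (simp add: hdist_square ip_simps ip_sym[of y x] ip_sym[of z y] ip_sym[of z x])
    also have "\<dots> \<le> (hdist H x y)\<^sup>2 + 2 * (hdist H x y * hdist H y z) + (hdist H y z)\<^sup>2"
      using ip_le_hnorm_mult[of "x \<ominus>\<^bsub>H\<^esub> y" "y \<ominus>\<^bsub>H\<^esub> z"] that by (simp add: hdist_def)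
    finally show "(hdist H x z)\<^sup>2 \<le> (hdist H x y + hdist H y z)\<^sup>2"
      by (simp add: power2_sum)
  qed (simp add: hdist_def hnorm_nonneg)
qed

text \<open>The parallelogram law at the midpoint of \<open>x\<close> and \<open>y\<close>, which
  even gives equality.\<close>

lemma hdist_CN:
  assumes x: "x \<in> carrier H" and y: "y \<in> carrier H"
  shows "\<exists>m\<in>carrier H. \<forall>z\<in>carrier H.
    (hdist H z m)\<^sup>2 \<le> ((hdist H z x)\<^sup>2 + (hdist H z y)\<^sup>2) / 2 - (hdist H x y)\<^sup>2 / 4"
proof (intro bexI ballI)
  show m: "(1/2) \<odot>\<^bsub>H\<^esub> (x \<oplus>\<^bsub>H\<^esub> y) \<in> carrier H" by (intro smult_in_carrier M.a_closed x y)
  fix z assume z: "z \<in> carrier H"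
  show "(hdist H z ((1/2) \<odot>\<^bsub>H\<^esub> (x \<oplus>\<^bsub>H\<^esub> y)))\<^sup>2
      \<le> ((hdist H z x)\<^sup>2 + (hdist H z y)\<^sup>2) / 2 - (hdist H x y)\<^sup>2 / 4"
    using x y z m by (simp add: hdist_square ip_simps ip_sym[of y x] field_simps)
qed

lemma circumcentre:
  assumes "B \<subseteq> carrier H" "B \<noteq> {}" "p0 \<in> carrier H" "\<And>z. z \<in> B \<Longrightarrow> hdist H z p0 \<le> r0"
  obtains c where "c \<in> carrier H" "\<And>z. z \<in> B \<Longrightarrow> hdist H z c \<le> r0"
    "\<And>f. (\<And>x. x \<in> carrier H \<Longrightarrow> f x \<in> carrier H) \<Longrightarrow>
         (\<And>x y. x \<in> carrier H \<Longrightarrow> y \<in> carrier H \<Longrightarrow> hdist H (f x) (f y) = hdist H x y) \<Longrightarrow>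
         B \<subseteq> f ` B \<Longrightarrow> f c = c"
proof -
  have "\<exists>c\<in>carrier H. (\<forall>z\<in>B. hdist H z c \<le> r0) \<and>
      (\<forall>f. (\<forall>x\<in>carrier H. f x \<in> carrier H) \<and>
           (\<forall>x\<in>carrier H. \<forall>y\<in>carrier H. hdist H (f x) (f y) = hdist H x y) \<and> B \<subseteq> f ` B \<longrightarrow> f c = c)"
    by (rule circumcentre_fixed[OF mcomplete_carrier hdist_CN]) (use assms in auto)
  then obtain c where c: "c \<in> carrier H" "\<forall>z\<in>B. hdist H z c \<le> r0"
      "\<forall>f. (\<forall>x\<in>carrier H. f x \<in> carrier H) \<and>
           (\<forall>x\<in>carrier H. \<forall>y\<in>carrier H. hdist H (f x) (f y) = hdist H x y) \<and> B \<subseteq> f ` B \<longrightarrow> f c = c"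
    by (elim bexE conjE) (rule that)
  show ?thesis
  proof (rule that[OF c(1)])
    show "hdist H z c \<le> r0" if "z \<in> B" for z using c(2) that by (rule bspec)
    show "f c = c" if "\<And>x. x \<in> carrier H \<Longrightarrow> f x \<in> carrier H"
      "\<And>x y. x \<in> carrier H \<Longrightarrow> y \<in> carrier H \<Longrightarrow> hdist H (f x) (f y) = hdist H x y" "B \<subseteq> f ` B" for f
      by (rule c(3)[rule_format]) (use that in blast)
  qed
qed

lemma psd_kernel_ip:
  assumes "\<And>x. f x \<in> carrier H"
  shows "psd_kernel (\<lambda>x y. ip H (f x) (f y))"
  unfolding psd_kernel_def
proof (intro conjI allI)
  show "ip H (f x) (f y) = ip H (f y) (f x)" for x y
    by (intro ip_sym assms)
next
  fix n :: nat and x :: "nat \<Rightarrow> 'a" and c :: "nat \<Rightarrow> real"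
  \<comment> \<open>\<open>w\<close> is the combination of the \<open>f (x i)\<close> with
    coefficients \<open>c i\<close>, characterised by its inner products. The form is then
    \<open>ip H w w\<close>.\<close>
  have "\<exists>w\<in>carrier H. \<forall>z\<in>carrier H. ip H w z = (\<Sum>i<n. c i * ip H (f (x i)) z)"
  proof (induction n)
    case 0
    show ?case by (intro bexI[of _ "\<zero>\<^bsub>H\<^esub>"]) (auto simp: ip_zero)
  next
    case (Suc n)
    then obtain w where w: "w \<in> carrier H"
      "\<forall>z\<in>carrier H. ip H w z = (\<Sum>i<n. c i * ip H (f (x i)) z)" by blast
    then show ?case
      by (intro bexI[of _ "w \<oplus>\<^bsub>H\<^esub> c n \<odot>\<^bsub>H\<^esub> f (x n)"])
         (auto simp: ip_simps assms smult_in_carrier)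
  qed
  then obtain w where w: "w \<in> carrier H"
    "\<And>z. z \<in> carrier H \<Longrightarrow> ip H w z = (\<Sum>i<n. c i * ip H (f (x i)) z)" by blast
  have "(\<Sum>i<n. \<Sum>j<n. c i * c j * ip H (f (x i)) (f (x j)))
      = (\<Sum>i<n. c i * (\<Sum>j<n. c j * ip H (f (x j)) (f (x i))))"
    by (simp add: sum_distrib_left mult.assoc ip_sym[OF assms assms])
  also have "\<dots> = (\<Sum>i<n. c i * ip H (f (x i)) w)"
    by (simp add: w(2)[symmetric] assms ip_sym[OF w(1)])
  also have "\<dots> = ip H w w" by (simp add: w)
  finally show "0 \<le> (\<Sum>i<n. \<Sum>j<n. c i * c j * ip H (f (x i)) (f (x j)))"
    using ip_nonneg[OF w(1)] by simp
qed

lemma inj_smult: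
  assumes "x \<in> carrier H" "x \<noteq> \<zero>\<^bsub>H\<^esub>"
  shows "inj (\<lambda>r. r \<odot>\<^bsub>H\<^esub> x)"
proof (rule injI)
  fix r s assume "r \<odot>\<^bsub>H\<^esub> x = s \<odot>\<^bsub>H\<^esub> x"
  then have "r * ip H x x = s * ip H x x" by (metis ip_smult assms(1))
  then show "r = s" using ip_eq_0 assms by auto
qed

text \<open>The line through \<open>x\<close> already has as many points as
  \<open>ell2 \<times> ell2\<close>. Pairs are provided for because complexifications will be
  transported as well.\<close>

lemma ex_inj_ell2_prod:
  assumes "x \<in> carrier H" "x \<noteq> \<zero>\<^bsub>H\<^esub>"
  shows "\<exists>j :: ell2 \<times> ell2 \<Rightarrow> 'v. inj j"
proof -
  obtain f :: "ell2 \<times> ell2 \<Rightarrow> real" where "inj f" using ex_inj_ell2_prod_real by blast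
  then have "inj ((\<lambda>r. r \<odot>\<^bsub>H\<^esub> x) \<circ> f)" by (rule inj_compose[OF inj_smult[OF assms]])
  then show ?thesis by blast
qed

lemma tendsto_hdist:
  fixes h :: "'g::topological_space \<Rightarrow> 'v"
  assumes "continuous_map euclidean (htopology H) h" "u \<longlonglongrightarrow> a"
  shows "(\<lambda>k. hdist H (h (u k)) (h a)) \<longlonglongrightarrow> 0"
proof (rule tendstoI)
  fix e :: real assume "0 < e"
  then have "\<exists>V. openin euclidean V \<and> a \<in> V \<and> (\<forall>y\<in>V. h y \<in> mball (h a) e)"
    using assms(1) unfolding htopology_def continuous_map_to_metric by (metis UNIV_I topspace_euclidean)
  then obtain V where V: "open V" "a \<in> V" "\<And>y. y \<in> V \<Longrightarrow> h y \<in> mball (h a) e"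
    by (metis open_openin)
  have "\<forall>\<^sub>F k in sequentially. u k \<in> V"
    using assms(2) V(1,2) by (rule topological_tendstoD)
  then show "\<forall>\<^sub>F k in sequentially. dist (hdist H (h (u k)) (h a)) 0 < e"
    by eventually_elim (use V(3) in \<open>simp add: in_mball commute[of _ "h a"]\<close>)
qed

text \<open>By the quadrilateral inequality the distance of two moving points changes by at most the
  sum of their displacements.\<close>

lemma tendsto_hdist2:
  fixes h :: "'g::topological_space \<Rightarrow> 'v"
  assumes h: "continuous_map euclidean (htopology H) h" "\<And>g. h g \<in> carrier H"
    and "u \<longlonglongrightarrow> a" "v \<longlonglongrightarrow> b"
  shows "(\<lambda>k. hdist H (h (u k)) (h (v k))) \<longlonglongrightarrow> hdist H (h a) (h b)"
proof (rule LIM_zero_cancel, rule Lim_null_comparison)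
  show "(\<lambda>k. hdist H (h (u k)) (h a) + hdist H (h (v k)) (h b)) \<longlonglongrightarrow> 0"
    using tendsto_add[OF tendsto_hdist[OF h(1) assms(3)] tendsto_hdist[OF h(1) assms(4)]] by simp
  have "\<bar>hdist H (h (u k)) (h (v k)) - hdist H (h a) (h b)\<bar>
      \<le> hdist H (h (u k)) (h a) + hdist H (h (v k)) (h b)" for k
    using triangle[OF h(2) h(2) h(2), of "u k" "v k" a] triangle[OF h(2) h(2) h(2), of a "v k" b]
      triangle[OF h(2) h(2) h(2), of a b "u k"] triangle[OF h(2) h(2) h(2), of "u k" b "v k"]
      commute[of "h (u k)" "h a"] commute[of "h (v k)" "h b"]
    by linarith
  then show "\<forall>\<^sub>F k in sequentially. norm (hdist H (h (u k)) (h (v k)) - hdist H (h a) (h b))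
      \<le> hdist H (h (u k)) (h a) + hdist H (h (v k)) (h b)"
    by simp
qed

end

section \<open>The underlying real Hilbert space of a complex one\<close>

definition realification :: "(complex, 'v) inner_product_space \<Rightarrow> (real, 'v) inner_product_space" where
  "realification H = \<lparr>carrier = carrier H, mult = mult H, one = one H, zero = zero H, add = add H,
     smult = (\<lambda>r. smult H (complex_of_real r)), ip = (\<lambda>x y. Re (ip H x y))\<rparr>"

lemma realification_simps [simp]:
  "carrier (realification H) = carrier H" "zero (realification H) = zero H"
  "add (realification H) = add H" "ip (realification H) x y = Re (ip H x y)"
  "smult (realification H) r x = smult H (complex_of_real r) x"
  "x \<ominus>\<^bsub>realification H\<^esub> y = x \<ominus>\<^bsub>H\<^esub> y"
  by (simp_all add: realification_def a_minus_def a_inv_def m_inv_def)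

text \<open>\<open>ip H x x\<close> is a non-negative real, so taking real parts keeps the norm;
  distance and completeness carry over unchanged.\<close>

lemma
  assumes "complex_hilbert_space H"
  shows hnorm_realification: "x \<in> carrier H \<Longrightarrow> hnorm (realification H) x = hnorm H x"
    and hdist_realification: "hdist (realification H) = hdist H"
    and real_hilbert_realification: "real_hilbert_space (realification H)"
proof -
  interpret Module.module scalars H
    using assms unfolding hilbert_space_def by blast
  have nonneg: "ip H x x \<in> \<real>\<^sub>\<ge>\<^sub>0" if "x \<in> carrier H" for x
    using assms that unfolding hilbert_space_def by blast
  show norm: "hnorm (realification H) x = hnorm H x" if "x \<in> carrier H" for x
    using nonneg[OF that] by (auto simp: hnorm_def nonneg_Reals_def)
  then show dist: "hdist (realification H) = hdist H"
    by (auto simp: hdist_def fun_eq_iff)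
  have module: "Module.module scalars (realification H)"
  proof (rule Module.moduleI)
    show "abelian_group (realification H)"
      by (rule abelian_groupI)
         (auto simp: M.a_ac intro: bexI[of _ "\<ominus>\<^bsub>H\<^esub> x" for x] M.l_neg M.a_inv_closed)
  qed (use smult_closed smult_l_distr smult_r_distr smult_assoc1 smult_one
       in \<open>auto simp: cring_scalars[unfolded scalars_def] scalars_def\<close>)
  have sym: "Re (ip H y x) = Re (ip H x y)" if "x \<in> carrier H" "y \<in> carrier H" for x y
  proof -
    have "ip H y x = cnj (ip H x y)" using assms that unfolding hilbert_space_def by blast
    from arg_cong[OF this, of Re] show ?thesis by simp
  qed
  have add: "Re (ip H (x \<oplus>\<^bsub>H\<^esub> y) z) = Re (ip H x z) + Re (ip H y z)"
    if "x \<in> carrier H" "y \<in> carrier H" "z \<in> carrier H" for x y z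
  proof -
    have "ip H (x \<oplus>\<^bsub>H\<^esub> y) z = ip H x z + ip H y z" using assms that unfolding hilbert_space_def by blast
    then show ?thesis by simp
  qed
  have smult: "Re (ip H (complex_of_real a \<odot>\<^bsub>H\<^esub> x) y) = a * Re (ip H x y)"
    if "x \<in> carrier H" "y \<in> carrier H" for x y a
  proof -
    have "ip H (complex_of_real a \<odot>\<^bsub>H\<^esub> x) y = complex_of_real a * ip H x y"
      using assms that unfolding hilbert_space_def by blast
    then show ?thesis by simp
  qed
  have pos: "Re (ip H x x) \<in> \<real>\<^sub>\<ge>\<^sub>0" if "x \<in> carrier H" for x
    using nonneg[OF that] by (auto simp: nonneg_Reals_def)
  have definite: "x = \<zero>\<^bsub>H\<^esub>" if "x \<in> carrier H" "Re (ip H x x) = 0" for x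
  proof -
    have "ip H x x = 0" using nonneg[OF that(1)] that(2) by (auto simp: nonneg_Reals_def)
    then show ?thesis using assms that(1) unfolding hilbert_space_def by blast
  qed
  have complete: "Metric_space.mcomplete (carrier H) (hdist H)"
    using assms unfolding hilbert_space_def by blast
  show "real_hilbert_space (realification H)"
    unfolding hilbert_space_def dist realification_simps
    by (intro conjI ballI allI impI module sym add smult pos definite complete)
qed

section \<open>Transport of a Hilbert space along an injection\<close>

definition transported ::
  "('b::ab_group_add \<Rightarrow> 'v) \<Rightarrow> 'b set \<Rightarrow> ('k \<Rightarrow> 'b \<Rightarrow> 'b) \<Rightarrow> ('b \<Rightarrow> 'b \<Rightarrow> 'k) \<Rightarrow> ('k, 'v) inner_product_space" where
  "transported f V sc B = \<lparr>carrier = f ` V, mult = (\<lambda>x y. x), one = f 0, zero = f 0,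
     add = (\<lambda>x y. f (the_inv f x + the_inv f y)), smult = (\<lambda>a x. f (sc a (the_inv f x))),
     ip = (\<lambda>x y. B (the_inv f x) (the_inv f y))\<rparr>"

text \<open>Real and complex scalars are treated at once. \<open>B_norm\<close> ties the form
  \<open>B\<close> to the norm of the Banach type, from which the closed subspace \<open>V\<close>,
  and hence its copy in \<open>'v\<close>, inherits completeness.\<close>

locale transport =
  fixes f :: "'b::banach \<Rightarrow> 'v" and V :: "'b set"
    and sc :: "'k::real_normed_field \<Rightarrow> 'b \<Rightarrow> 'b" and B :: "'b \<Rightarrow> 'b \<Rightarrow> 'k" and cj :: "'k \<Rightarrow> 'k"
  assumes inj: "inj f"
    and subspace_V: "subspace V" and closed_V: "closed V"
    and sc_V: "x \<in> V \<Longrightarrow> sc a x \<in> V"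
    and sc_add: "sc a (x + y) = sc a x + sc a y" and sc_add_left: "sc (a + b) x = sc a x + sc b x"
    and sc_mult: "sc (a * b) x = sc a (sc b x)" and sc_1: "sc 1 x = x"
    and B_sym: "B y x = cj (B x y)" and B_add: "B (x + y) z = B x z + B y z"
    and B_sc: "B (sc a x) y = a * B x y" and B_norm: "B x x = of_real ((norm x)\<^sup>2)"
begin

definition H :: "('k, 'v) inner_product_space" where
  "H = transported f V sc B"

lemma H_simps [simp]:
  "carrier H = f ` V" "\<zero>\<^bsub>H\<^esub> = f 0" "f x \<oplus>\<^bsub>H\<^esub> f y = f (x + y)" "a \<odot>\<^bsub>H\<^esub> f x = f (sc a x)"
  "ip H (f x) (f y) = B x y"
  by (simp_all add: H_def transported_def the_inv_f_f[OF inj])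

lemma f_eq_iff [simp]: "f x = f y \<longleftrightarrow> x = y"
  by (rule inj_eq[OF inj])

lemma abelian_group_H: "abelian_group H"
proof (rule abelian_groupI)
  show "\<exists>y\<in>carrier H. y \<oplus>\<^bsub>H\<^esub> x = \<zero>\<^bsub>H\<^esub>" if x: "x \<in> carrier H" for x
  proof -
    obtain u where "u \<in> V" "x = f u" using x by auto
    then show ?thesis by (intro bexI[of _ "f (- u)"]) (auto simp: subspace_neg[OF subspace_V])
  qed
qed (auto simp: subspace_add[OF subspace_V] subspace_0[OF subspace_V] algebra_simps)

sublocale H: abelian_group H
  by (rule abelian_group_H)

lemma diff_H: "u \<in> V \<Longrightarrow> v \<in> V \<Longrightarrow> f u \<ominus>\<^bsub>H\<^esub> f v = f (u - v)"
  using H.minus_equality[of "f (- v)" "f v"] subspace_neg[OF subspace_V, of v]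
  by (simp add: a_minus_def)

lemma hnorm_H: "hnorm H (f u) = norm u"
  by (simp add: hnorm_def B_norm norm_power)

lemma hdist_H: "u \<in> V \<Longrightarrow> v \<in> V \<Longrightarrow> hdist H (f u) (f v) = dist u v"
  by (simp add: hdist_def diff_H hnorm_H dist_norm)

sublocale Metric_space "f ` V" "hdist H"
proof
  show "0 \<le> hdist H x y" for x y by (simp add: hdist_def hnorm_def)
  show "hdist H x y = hdist H y x" for x y
  proof (cases "x \<in> f ` V \<and> y \<in> f ` V")
    case True
    then show ?thesis by (auto simp: hdist_H dist_commute)
  next
    case False
    then show ?thesis unfolding hdist_def H_simps by (simp only: conj_commute if_not_P) auto
  qed
qed (auto simp: hdist_H dist_triangle)

lemma mcomplete_H: "Metric_space.mcomplete (f ` V) (hdist H)"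
  unfolding mcomplete_def
proof (intro allI impI)
  fix \<sigma> assume \<sigma>: "MCauchy \<sigma>"
  then have "\<forall>n. \<exists>u\<in>V. \<sigma> n = f u" by (auto simp: MCauchy_def image_subset_iff image_iff)
  then obtain u where u: "\<And>n. u n \<in> V" "\<And>n. \<sigma> n = f (u n)" by metis
  have "Cauchy u"
    using \<sigma> unfolding MCauchy_def Cauchy_def by (simp add: u hdist_H)
  then obtain l where l: "u \<longlonglongrightarrow> l" by (auto simp: Cauchy_convergent_iff convergent_def)
  then have "l \<in> V" using closed_V u(1) by (auto simp: closed_sequential_limits)
  then have "limitin mtopology \<sigma> (f l) sequentially"
    using l unfolding limit_metric_sequentially lim_sequentially by (auto simp: u hdist_H)
  then show "\<exists>x. limitin mtopology \<sigma> x sequentially" by blast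
qed

lemma hilbert_space_H: "hilbert_space cj H"
  unfolding hilbert_space_def
proof (intro conjI ballI allI impI)
  show "Module.module scalars H"
    by (rule Module.moduleI)
       (auto simp: cring_scalars[unfolded scalars_def] scalars_def abelian_group_H sc_V
          sc_add sc_add_left sc_mult sc_1)
  show "Metric_space.mcomplete (carrier H) (hdist H)" using mcomplete_H by simp
next
  fix x y assume "x \<in> carrier H" "y \<in> carrier H"
  then show "ip H y x = cj (ip H x y)" by clarsimp (rule B_sym)
qed (auto simp: B_add B_sc B_norm simp del: of_real_power)

lemma htopology_H: "htopology H = mtopology"
  by (simp add: htopology_def)

lemma continuous_map_f: "continuous_map (top_of_set V) (htopology H) f"
  unfolding htopology_H continuous_map_to_metric
proof (intro ballI allI impI)
  fix u and e :: real assume "u \<in> topspace (top_of_set V)" "0 < e"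
  then show "\<exists>U. openin (top_of_set V) U \<and> u \<in> U \<and> (\<forall>v\<in>U. f v \<in> mball (f u) e)"
    by (intro exI[of _ "V \<inter> ball u e"]) (auto simp: openin_open_Int hdist_H)
qed

lemma continuous_map_the_inv_f: "continuous_map (htopology H) (top_of_set V) (the_inv f)"
  unfolding continuous_map_in_subtopology
proof
  show "continuous_map (htopology H) euclidean (the_inv f)"
    unfolding mtopology_is_euclidean[symmetric] Met_TC.continuous_map_to_metric
  proof (intro ballI allI impI)
    fix x and e :: real assume x: "x \<in> topspace (htopology H)" and "0 < e"
    then obtain u where u: "u \<in> V" "x = f u" by (auto simp: htopology_H)
    show "\<exists>U. openin (htopology H) U \<and> x \<in> U \<and> (\<forall>y\<in>U. the_inv f y \<in> Met_TC.mball (the_inv f x) e)"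
    proof (intro exI conjI ballI)
      show "openin (htopology H) (mball x e)" by (simp add: htopology_H)
      show "x \<in> mball x e" using u \<open>0 < e\<close> by simp
      show "the_inv f y \<in> Met_TC.mball (the_inv f x) e" if "y \<in> mball x e" for y
        using that u by (auto simp: hdist_H the_inv_f_f[OF inj])
    qed
  qed
  show "the_inv f \<in> topspace (htopology H) \<rightarrow> V"
    by (auto simp: htopology_H the_inv_f_f[OF inj])
qed

end

locale real_transport =
  fixes f :: "'b::{real_inner, banach} \<Rightarrow> 'v" and V :: "'b set"
  assumes "inj f" "subspace V" "closed V"

sublocale real_transport \<subseteq> transport f V "(*\<^sub>R)" inner "\<lambda>t. t"
  using real_transport_axioms
  by unfold_locales
     (auto simp: real_transport_def subspace_scale inner_commute inner_add_left algebra_simps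
        power2_norm_eq_inner)

definition complex_scale :: "complex \<Rightarrow> 'a::real_vector \<times> 'a \<Rightarrow> 'a \<times> 'a" where
  "complex_scale a p = (Re a *\<^sub>R fst p - Im a *\<^sub>R snd p, Re a *\<^sub>R snd p + Im a *\<^sub>R fst p)"

text \<open>The sesquilinear extension of the real inner product, linear in the first argument as
  \<open>hilbert_space\<close> demands.\<close>

definition complex_inner :: "'a::real_inner \<times> 'a \<Rightarrow> 'a \<times> 'a \<Rightarrow> complex" where
  "complex_inner p q =
     Complex (fst p \<bullet> fst q + snd p \<bullet> snd q) (snd p \<bullet> fst q - fst p \<bullet> snd q)"

text \<open>The pair \<open>(x, y)\<close> stands for the vector \<open>x + \<i> y\<close> of the complexification.\<close>

locale complex_transport =
  fixes f :: "'b::{real_inner, banach} \<times> 'b \<Rightarrow> 'v" and M :: "'b set"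
  assumes "inj f" "subspace M" "closed M"

sublocale complex_transport \<subseteq> transport f "M \<times> M" complex_scale complex_inner cnj
proof
  have M: "subspace M" "closed M" and "inj f"
    using complex_transport_axioms by (auto simp: complex_transport_def)
  then show "inj f" "subspace (M \<times> M)" "closed (M \<times> M)"
    by (auto intro: subspace_Times closed_Times)
  show "complex_scale a x \<in> M \<times> M" if "x \<in> M \<times> M" for a x
    using that by (auto simp: complex_scale_def intro!: subspace_add subspace_diff subspace_scale M)
  show "complex_inner x x = complex_of_real ((norm x)\<^sup>2)" for x
    by (cases x) (simp add: complex_inner_def norm_Pair complex_eq_iff power2_norm_eq_inner inner_commute)
qed (auto simp: complex_scale_def complex_inner_def complex_eq_iff prod_eq_iff inner_add_left
       inner_diff_left algebra_simps inner_commute)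

section \<open>Weak Property (T) implies Property (FH)\<close>

text \<open>Weak Property (T) concerns complex spaces, whereas the kernels are real:
  \<open>U g\<close> acts on both components of the complexification of \<open>M\<close>.\<close>

locale complexified_family = invariant_family F
  for F :: "'g::topological_group_add \<Rightarrow> 'i \<Rightarrow> 'a::{real_inner, banach}" +
  fixes j :: "'a \<times> 'a \<Rightarrow> 'v"
  assumes inj_j: "inj j"
begin

sublocale T: complex_transport j M
  by unfold_locales (rule inj_j subspace_M closed_M)+

definition \<pi> :: "'g \<Rightarrow> 'v \<Rightarrow> 'v" where
  "\<pi> g x = (let p = the_inv j x in j (U g (fst p), U g (snd p)))"

lemma \<pi>_j: "\<pi> g (j (u, v)) = j (U g u, U g v)"
  by (simp add: \<pi>_def the_inv_f_f[OF inj_j])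

lemma unitary_representation_\<pi>: "unitary_representation T.H \<pi>"
  unfolding unitary_representation_def unitary_operator_def
proof (intro conjI allI ballI)
  fix g :: 'g
  have "\<pi> (- g) (\<pi> g x) = x" "\<pi> g (\<pi> (- g) x) = x" "\<pi> g x \<in> j ` (M \<times> M)" if "x \<in> j ` (M \<times> M)" for x g
    using that by (auto simp: \<pi>_j U_add[symmetric] U_0 U_in_M)
  then show "bij_betw (\<pi> g) (carrier T.H) (carrier T.H)"
    by (intro bij_betw_byWitness[of _ "\<pi> (- g)"]) auto
next
  fix g x y assume "x \<in> carrier T.H" "y \<in> carrier T.H"
  then show "\<pi> g (x \<oplus>\<^bsub>T.H\<^esub> y) = \<pi> g x \<oplus>\<^bsub>T.H\<^esub> \<pi> g y" "ip T.H (\<pi> g x) (\<pi> g y) = ip T.H x y"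
    by (auto simp: \<pi>_j U_plus complex_inner_def U_inner)
next
  fix g a x assume "x \<in> carrier T.H"
  then obtain u v where x: "u \<in> M" "v \<in> M" "x = j (u, v)" by auto
  have "U g (Re a *\<^sub>R u - Im a *\<^sub>R v) = Re a *\<^sub>R U g u - Im a *\<^sub>R U g v"
    using U_linear[OF x(1,2), of g "Re a" "- Im a"] by simp
  moreover have "U g (Re a *\<^sub>R v + Im a *\<^sub>R u) = Re a *\<^sub>R U g v + Im a *\<^sub>R U g u"
    by (rule U_linear[OF x(2,1)])
  ultimately show "\<pi> g (a \<odot>\<^bsub>T.H\<^esub> x) = a \<odot>\<^bsub>T.H\<^esub> \<pi> g x"
    by (simp add: x(3) \<pi>_j complex_scale_def)
next
  fix g h \<xi> assume "\<xi> \<in> carrier T.H"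
  then show "\<pi> (g + h) \<xi> = \<pi> g (\<pi> h \<xi>)" by (auto simp: \<pi>_j U_add)
qed

lemma strongly_continuous_\<pi>: "strongly_continuous T.H \<pi>"
  unfolding strongly_continuous_def
proof
  fix \<xi> assume "\<xi> \<in> carrier T.H"
  then obtain u v where \<xi>: "u \<in> M" "v \<in> M" "\<xi> = j (u, v)" by auto
  have "continuous_on UNIV (\<lambda>g. (U g u, U g v))"
    by (intro continuous_on_Pair continuous_U \<xi>)
  then have "continuous_map euclidean (top_of_set (M \<times> M)) (\<lambda>g. (U g u, U g v))"
    by (simp add: continuous_map_in_subtopology U_in_M \<xi>)
  from continuous_map_compose[OF this T.continuous_map_f]
  show "continuous_map euclidean (htopology T.H) (\<lambda>g. \<pi> g \<xi>)"
    by (simp add: \<xi>(3) \<pi>_j o_def)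
qed

end

text \<open>For a bounded sequence, weak convergence to 0 passes to limits of test vectors, so it
  can be checked on a spanning set. The proof divides by \<open>C + 1\<close> since \<open>C\<close>
  may be 0.\<close>

lemma closed_weakly_null:
  fixes x :: "nat \<Rightarrow> 'a::real_inner"
  assumes "\<And>k. norm (x k) \<le> C"
  shows "closed {y. (\<lambda>k. x k \<bullet> y) \<longlonglongrightarrow> 0}"
  unfolding closed_sequential_limits
proof (intro allI impI, elim conjE)
  fix v l assume v: "\<forall>n. v n \<in> {y. (\<lambda>k. x k \<bullet> y) \<longlonglongrightarrow> 0}" "v \<longlonglongrightarrow> l"
  have C: "0 \<le> C" using assms[of 0] norm_ge_zero order_trans by blast
  have "(\<lambda>k. x k \<bullet> l) \<longlonglongrightarrow> 0"
  proof (rule tendstoI)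
    fix e :: real assume "0 < e"
    then have "\<forall>\<^sub>F n in sequentially. dist (v n) l < e / 2 / (C + 1)"
      using v(2) C by (intro tendstoD) auto
    then obtain n where n: "dist (v n) l < e / 2 / (C + 1)"
      using eventually_happens'[OF sequentially_bot] by blast
    have "(\<lambda>k. x k \<bullet> v n) \<longlonglongrightarrow> 0" using v(1) by blast
    then have "\<forall>\<^sub>F k in sequentially. dist (x k \<bullet> v n) 0 < e / 2"
      using \<open>0 < e\<close> by (intro tendstoD) auto
    then show "\<forall>\<^sub>F k in sequentially. dist (x k \<bullet> l) 0 < e"
    proof eventually_elim
      case (elim k)
      have "\<bar>x k \<bullet> (v n - l)\<bar> \<le> norm (x k) * dist (v n) l"
        using Cauchy_Schwarz_ineq2[of "x k" "v n - l"] by (simp add: dist_norm)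
      also have "\<dots> \<le> (C + 1) * dist (v n) l"
        by (intro mult_right_mono) (use assms[of k] in auto)
      also have "\<dots> < e / 2" using n C by (simp add: pos_less_divide_eq algebra_simps)
      finally show ?case using elim unfolding inner_diff_right dist_real_def by linarith
    qed
  qed
  then show "l \<in> {y. (\<lambda>k. x k \<bullet> y) \<longlonglongrightarrow> 0}" by simp
qed

locale affine_action = real_hilbert H
  for H :: "(real, 'v) inner_product_space" +
  fixes \<alpha> :: "'g::{polish_space, topological_group_add} \<Rightarrow> 'v \<Rightarrow> 'v"
  assumes action: "continuous_affine_isometric_action H \<alpha>"
begin

definition b :: "'g \<Rightarrow> 'v" where
  "b g = \<alpha> g \<zero>\<^bsub>H\<^esub>"

definition D :: "'g \<Rightarrow> 'g \<Rightarrow> real" where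
  "D g h = hdist H (b g) (b h)"

lemma \<alpha>_in: "x \<in> carrier H \<Longrightarrow> \<alpha> g x \<in> carrier H"
  and \<alpha>_isometry: "x \<in> carrier H \<Longrightarrow> y \<in> carrier H \<Longrightarrow> hdist H (\<alpha> g x) (\<alpha> g y) = hdist H x y"
  and \<alpha>_0: "x \<in> carrier H \<Longrightarrow> \<alpha> 0 x = x"
  and \<alpha>_add: "x \<in> carrier H \<Longrightarrow> \<alpha> (g + h) x = \<alpha> g (\<alpha> h x)"
  using action unfolding continuous_affine_isometric_action_def affine_isometry_def by blast+

lemma b_in: "b g \<in> carrier H"
  by (simp add: b_def \<alpha>_in)

lemma b_add: "b (g + h) = \<alpha> g (b h)"
  by (simp add: b_def \<alpha>_add)

lemma continuous_b: "continuous_map euclidean (htopology H) b"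
proof -
  have "continuous_map euclidean (prod_topology euclidean (htopology H)) (\<lambda>g. (g, \<zero>\<^bsub>H\<^esub>))"
    by (simp add: continuous_map_paired htopology_def)
  moreover have "continuous_map (prod_topology euclidean (htopology H)) (htopology H) (\<lambda>(g, x). \<alpha> g x)"
    using action unfolding continuous_affine_isometric_action_def by blast
  ultimately show ?thesis
    using continuous_map_compose by (fastforce simp: o_def b_def[abs_def])
qed

lemma D_invariant: "D (a + g) (a + h) = D g h"
  by (simp add: D_def b_add \<alpha>_isometry b_in)

lemma D_triangle: "D g k \<le> D g h + D h k"
  unfolding D_def by (intro triangle b_in)

lemma D_sym: "D g h = D h g"
  unfolding D_def by (rule commute)

lemma tendsto_D: "u \<longlonglongrightarrow> x \<Longrightarrow> v \<longlonglongrightarrow> y \<Longrightarrow> (\<lambda>k. D (u k) (v k)) \<longlonglongrightarrow> D x y"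
  unfolding D_def by (rule tendsto_hdist2[OF continuous_b b_in])

text \<open>Boundedness in the group sense enters here: as an admissible pseudometric,
  \<open>D\<close> has finite diameter on every \<open>group_bounded\<close> set.\<close>

lemma pseudometric_D: "continuous_left_invariant_pseudometric D"
  unfolding continuous_left_invariant_pseudometric_def
proof (intro conjI allI)
  show "continuous_on UNIV (\<lambda>(x, y). D x y)"
    unfolding continuous_on_sequentially
  proof (intro allI ballI impI, elim conjE)
    fix u :: "nat \<Rightarrow> 'g \<times> 'g" and p assume "u \<longlonglongrightarrow> p"
    then show "((\<lambda>(x, y). D x y) \<circ> u) \<longlonglongrightarrow> (case p of (x, y) \<Rightarrow> D x y)"
      by (simp add: o_def split_beta tendsto_D tendsto_fst tendsto_snd)
  qed
  show "0 \<le> D x y" "D x x = 0" "D x y = D y x" "D x z \<le> D x y + D y z" "D (g + x) (g + y) = D x y"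
    for g x y z
    by (rule D_sym D_triangle D_invariant | simp add: D_def b_in)+
qed

lemma fixed_point_if_bounded:
  assumes "\<And>g. D g 0 \<le> r"
  shows "\<exists>x\<in>carrier H. \<forall>g. \<alpha> g x = x"
proof -
  obtain c where "c \<in> carrier H" and
    c: "\<And>f. (\<And>x. x \<in> carrier H \<Longrightarrow> f x \<in> carrier H) \<Longrightarrow>
         (\<And>x y. x \<in> carrier H \<Longrightarrow> y \<in> carrier H \<Longrightarrow> hdist H (f x) (f y) = hdist H x y) \<Longrightarrow>
         range b \<subseteq> f ` range b \<Longrightarrow> f c = c"
    by (rule circumcentre[of "range b" "b 0" r]) (use assms b_in in \<open>auto simp: D_def\<close>)
  have "\<alpha> g c = c" for g
  proof (rule c)
    have "b h = \<alpha> g (b (- g + h))" for h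
      by (simp add: b_add[symmetric] add.assoc[symmetric])
    then show "range b \<subseteq> \<alpha> g ` range b" by blast
  qed (simp_all add: \<alpha>_in \<alpha>_isometry)
  then show ?thesis using \<open>c \<in> carrier H\<close> by blast
qed

lemma bounded_on_group_bounded:
  assumes "group_bounded Q"
  shows "\<exists>C\<ge>0. \<forall>g\<in>Q. D g 0 \<le> C"
proof (cases "Q = {}")
  case False
  then obtain q where q: "q \<in> Q" by blast
  obtain C where C: "\<And>x y. x \<in> Q \<Longrightarrow> y \<in> Q \<Longrightarrow> D x y \<le> C"
    using assms pseudometric_D unfolding group_bounded_def bdd_above_def by blast
  have "D g 0 \<le> \<bar>C + D q 0\<bar>" if "g \<in> Q" for g
    using C[OF that q] D_triangle[of g 0 q] by linarith
  then show ?thesis by (intro exI[of _ "\<bar>C + D q 0\<bar>"]) simp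
qed auto

lemma unbounded_orbit_contradicts_weak_property_T:
  assumes T: "weak_property_T TYPE('g) TYPE('v)"
    and unbounded: "\<And>r. \<exists>g. r < D g 0"
  shows False
proof -
  have "\<forall>k. \<exists>g. real k < D g 0" using unbounded by blast
  from choice[OF this] obtain a where a: "\<And>k. real k < D (a k) 0" by blast
  \<comment> \<open>The origin is moved, so \<open>H\<close> is non-zero and \<open>'v\<close> has
    room for \<open>ell2 \<times> ell2\<close>.\<close>
  have "b (a 0) \<noteq> b 0" using a[of 0] by (auto simp: D_def b_in)
  then have "b (a 0) \<noteq> \<zero>\<^bsub>H\<^esub>" by (simp add: b_def \<alpha>_0)
  from ex_inj_ell2_prod[OF b_in this] obtain j :: "ell2 \<times> ell2 \<Rightarrow> 'v" where j: "inj j" by blast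
  define t where "t n = inverse (real (Suc n))" for n
  have t: "0 < t n" for n by (simp add: t_def)
  define K where "K n g h = exp (- (t n * (D g h)\<^sup>2))" for n g h
  obtain F :: "'g \<Rightarrow> nat \<Rightarrow> ell2" where F: "invariant_family F"
    and gram: "\<And>g h n m. F g n \<bullet> F h m = (if n = m then K n g h else 0)"
  proof -
    have "psd_kernel (K n)" for n
      using psd_kernel_gaussian[OF psd_kernel_ip[of b] less_imp_le[OF t[of n]]] b_in
      by (simp add: K_def[abs_def] D_def hdist_square)
    moreover have "(\<lambda>k. K n (u k) (v k)) \<longlonglongrightarrow> K n x y" if "u \<longlonglongrightarrow> x" "v \<longlonglongrightarrow> y" for n u v x y
      unfolding K_def by (intro tendsto_intros tendsto_D that)
    moreover have "K n (a + g) (a + h) = K n g h" for n a g h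
      by (simp add: K_def D_invariant)
    ultimately show ?thesis using psd_kernels_gram_family[of K] that by metis
  qed
  interpret complexified_family F j
    using F j by (simp add: complexified_family_def complexified_family_axioms_def)
  have K_diag: "K n g g = 1" for n g by (simp add: K_def D_def b_in)
  have norm_F: "norm (F g n) = 1" for g n by (simp add: norm_eq_sqrt_inner gram K_diag)
  have zero_M: "0 \<in> M" by (rule subspace_0[OF subspace_M])
  have U_zero: "U g 0 = 0" for g using U_norm[OF zero_M, of g] by simp
  have "almost_invariant_vectors_bounded T.H \<pi>"
    unfolding almost_invariant_vectors_bounded_def
  proof (intro allI impI)
    fix e :: real and Q :: "'g set" assume "0 < e" "group_bounded Q"
    then obtain C where C: "0 \<le> C" "\<And>g. g \<in> Q \<Longrightarrow> D g 0 \<le> C"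
      using bounded_on_group_bounded by blast
    \<comment> \<open>By \<open>1 - exp (- x) \<le> x\<close> the squared displacement of
      \<open>F 0 n\<close> on \<open>Q\<close> is at most \<open>2 * t n * C^2\<close>; the
      \<open>+ 1\<close> keeps the divisor positive when \<open>C = 0\<close>.\<close>
    have pos: "0 < 2 * C\<^sup>2 + 1" by (simp add: add_nonneg_pos)
    obtain n where n: "t n < (e/2)\<^sup>2 / (2 * C\<^sup>2 + 1)"
      unfolding t_def using reals_Archimedean[of "(e/2)\<^sup>2 / (2 * C\<^sup>2 + 1)"] \<open>0 < e\<close> pos
      by (metis divide_pos_pos half_gt_zero zero_less_power)
    have "hnorm T.H (\<pi> g (j (F 0 n, 0)) \<ominus>\<^bsub>T.H\<^esub> j (F 0 n, 0)) \<le> e/2" if "g \<in> Q" for g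
    proof -
      have "(dist (F g n) (F 0 n))\<^sup>2 = 2 - 2 * K n g 0"
        by (simp add: dist_gram_square gram K_diag)
      also have "\<dots> \<le> 2 * (t n * (D g 0)\<^sup>2)"
        using exp_ge_add_one_self[of "- (t n * (D g 0)\<^sup>2)"] by (simp add: K_def)
      also have "\<dots> \<le> 2 * (t n * C\<^sup>2)"
        using C(2)[OF that] t[of n] by (intro mult_left_mono power_mono) (auto simp: D_def)
      also have "\<dots> \<le> t n * (2 * C\<^sup>2 + 1)" using t[of n] by (simp add: algebra_simps)
      also have "\<dots> \<le> (e/2)\<^sup>2"
        using n unfolding pos_less_divide_eq[OF pos] by (rule less_imp_le)
      finally have "dist (F g n) (F 0 n) \<le> e/2"
        by (rule power2_le_imp_le) (use \<open>0 < e\<close> in simp)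
      moreover have "\<pi> g (j (F 0 n, 0)) \<ominus>\<^bsub>T.H\<^esub> j (F 0 n, 0) = j (F g n - F 0 n, 0)"
        using T.diff_H[of "(F g n, 0)" "(F 0 n, 0)"] by (simp add: \<pi>_j U_F U_zero F_in_M zero_M)
      ultimately show ?thesis
        by (simp only: T.hnorm_H norm_Pair dist_norm) simp
    qed
    \<comment> \<open>The margin \<open>e/2\<close> is spent here: a supremum preserves only
      non-strict bounds.\<close>
    then have "(SUP g\<in>Q. ereal (hnorm T.H (\<pi> g (j (F 0 n, 0)) \<ominus>\<^bsub>T.H\<^esub> j (F 0 n, 0)))) \<le> ereal (e/2)"
      by (intro SUP_least) simp
    also have "\<dots> < ereal e" using \<open>0 < e\<close> by simp
    finally show "\<exists>\<xi>\<in>carrier T.H. hnorm T.H \<xi> = 1 \<and>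
        (SUP g\<in>Q. ereal (hnorm T.H (\<pi> g \<xi> \<ominus>\<^bsub>T.H\<^esub> \<xi>))) < ereal e"
      by (intro bexI[of _ "j (F 0 n, 0)"]) (auto simp: T.hnorm_H norm_Pair norm_F F_in_M zero_M)
  qed
  then have "has_nonzero_invariant_vector T.H \<pi>"
    using T T.hilbert_space_H unitary_representation_\<pi> strongly_continuous_\<pi>
    unfolding weak_property_T_def by blast
  then obtain v w where "v \<in> M" "w \<in> M" "(v, w) \<noteq> 0" "\<And>g. U g v = v" "\<And>g. U g w = w"
    unfolding has_nonzero_invariant_vector_def by (auto simp: \<pi>_j)
  \<comment> \<open>Both components of the invariant vector are invariant, and one of them is
    non-zero.\<close>
  then obtain y where y: "y \<in> M" "y \<noteq> 0" "\<And>g. U g y = y" by (auto simp: prod_eq_iff)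
  \<comment> \<open>\<open>F (a k) n\<close> tends weakly to 0 in \<open>M\<close>: it is orthogonal
    to \<open>F h m\<close> for \<open>m \<noteq> n\<close>, and its inner product with
    \<open>F h n\<close> is a Gaussian in \<open>D (a k) h\<close>, which tends to infinity.\<close>
  have null: "M \<subseteq> {z. (\<lambda>k. F (a k) n \<bullet> z) \<longlonglongrightarrow> 0}" for n
  proof (rule M_subset)
    show "subspace {z. (\<lambda>k. F (a k) n \<bullet> z) \<longlonglongrightarrow> 0}"
      by (auto intro!: subspaceI tendsto_add_zero tendsto_mult_right_zero simp: inner_add_right)
    show "closed {z. (\<lambda>k. F (a k) n \<bullet> z) \<longlonglongrightarrow> 0}"
      by (rule closed_weakly_null[of _ 1]) (simp add: norm_F)
    fix h m
    have "filterlim (\<lambda>k. D (a k) h) at_top sequentially"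
    proof (rule filterlim_at_top_mono)
      show "filterlim (\<lambda>k. - D h 0 + real k) at_top sequentially"
        by (intro filterlim_tendsto_add_at_top[OF tendsto_const] filterlim_real_sequentially)
      show "\<forall>\<^sub>F k in sequentially. - D h 0 + real k \<le> D (a k) h"
      proof (rule always_eventually, rule allI)
        show "- D h 0 + real k \<le> D (a k) h" for k
          using a[of k] D_triangle[of "a k" 0 h] by linarith
      qed
    qed
    then have "filterlim (\<lambda>k. t n * (D (a k) h)\<^sup>2) at_top sequentially"
      by (intro filterlim_tendsto_pos_mult_at_top[OF tendsto_const t] filterlim_pow_at_top) auto
    then have "(\<lambda>k. K n (a k) h) \<longlonglongrightarrow> 0"
      unfolding K_def by (intro filterlim_compose[OF exp_at_bot]) (simp add: filterlim_uminus_at_bot)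
    then show "F h m \<in> {z. (\<lambda>k. F (a k) n \<bullet> z) \<longlonglongrightarrow> 0}"
      by (cases "n = m") (simp_all add: gram)
  qed
  have "y = 0"
  proof (rule M_eqI[OF y(1) zero_M])
    fix h n
    \<comment> \<open>Invariance of \<open>y\<close> makes this inner product independent of the
      group element, so the limit 0 along \<open>a\<close> is its constant value.\<close>
    have "F (a k) n \<bullet> y = y \<bullet> F h n" for k
      using U_inner_F[OF y(1), of "a k - h" h n] by (simp add: y(3) inner_commute)
    then have "(\<lambda>k. y \<bullet> F h n) \<longlonglongrightarrow> 0" using null[of n] y(1) by auto
    then show "y \<bullet> F h n = 0 \<bullet> F h n" by (simp add: LIMSEQ_const_iff)
  qed
  then show False using y(2) by contradiction
qed

end

theorem weak_property_T_imp_property_FH: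
  assumes "weak_property_T TYPE('g::{polish_space, topological_group_add}) TYPE('v)"
  shows "property_FH TYPE('g) TYPE('v)"
  unfolding property_FH_def
proof (intro allI impI, elim conjE)
  fix H :: "(real, 'v) inner_product_space" and \<alpha> :: "'g \<Rightarrow> 'v \<Rightarrow> 'v"
  assume "real_hilbert_space H" "continuous_affine_isometric_action H \<alpha>"
  then interpret affine_action H \<alpha> by unfold_locales
  show "\<exists>x\<in>carrier H. \<forall>g. \<alpha> g x = x"
  proof (cases "\<exists>r. \<forall>g. D g 0 \<le> r")
    case True
    then show ?thesis using fixed_point_if_bounded by blast
  next
    case False
    then show ?thesis using unbounded_orbit_contradicts_weak_property_T[OF assms] by (meson not_le)
  qed
qed

section \<open>Non-meagre sets in Polish groups\<close>

text \<open>This form of nowhere density is visibly carried along by translations.\<close>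

lemma nowhere_dense_iff:
  "nowhere_dense S \<longleftrightarrow> (\<forall>W. open W \<and> W \<noteq> {} \<longrightarrow> (\<exists>V. open V \<and> V \<noteq> {} \<and> V \<subseteq> W \<and> V \<inter> S = {}))"
proof
  assume nd: "nowhere_dense S"
  show "\<forall>W. open W \<and> W \<noteq> {} \<longrightarrow> (\<exists>V. open V \<and> V \<noteq> {} \<and> V \<subseteq> W \<and> V \<inter> S = {})"
  proof (intro allI impI, elim conjE)
    fix W :: "'a set" assume W: "open W" "W \<noteq> {}"
    have "W - closure S \<noteq> {}"
    proof
      assume "W - closure S = {}"
      then have "W \<subseteq> interior (closure S)" using W(1) by (intro interior_maximal) auto
      then show False using nd W(2) by (simp add: nowhere_dense_def)
    qed
    then show "\<exists>V. open V \<and> V \<noteq> {} \<and> V \<subseteq> W \<and> V \<inter> S = {}"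
      using W(1) closure_subset[of S] by (intro exI[of _ "W - closure S"]) (auto intro: open_Diff)
  qed
next
  assume *: "\<forall>W. open W \<and> W \<noteq> {} \<longrightarrow> (\<exists>V. open V \<and> V \<noteq> {} \<and> V \<subseteq> W \<and> V \<inter> S = {})"
  show "nowhere_dense S"
    unfolding nowhere_dense_def
  proof (rule ccontr)
    assume "interior (closure S) \<noteq> {}"
    then obtain V where V: "open V" "V \<noteq> {}" "V \<subseteq> interior (closure S)" "V \<inter> S = {}"
      using *[rule_format, of "interior (closure S)"] by auto
    then have "V \<inter> closure S = {}" using open_Int_closure_eq_empty by blast
    then show False using V(2,3) interior_subset by blast
  qed
qed

lemma nowhere_dense_subset: "nowhere_dense S \<Longrightarrow> T \<subseteq> S \<Longrightarrow> nowhere_dense T"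
  unfolding nowhere_dense_def using interior_mono[OF closure_mono[of T S]] by blast

lemma meagre_subset:
  assumes "meagre S" "T \<subseteq> S"
  shows "meagre T"
proof -
  obtain N :: "nat \<Rightarrow> 'a set" where N: "\<And>n. nowhere_dense (N n)" "S = (\<Union>n. N n)"
    using assms(1) by (auto simp: meagre_def)
  have "nowhere_dense (N n \<inter> T)" for n by (rule nowhere_dense_subset[OF N(1)]) auto
  moreover have "T = (\<Union>n. N n \<inter> T)" using N(2) assms(2) by auto
  ultimately show ?thesis unfolding meagre_def by (intro exI[of _ "\<lambda>n. N n \<inter> T"] conjI allI)
qed

lemma meagre_UN:
  fixes A :: "nat \<Rightarrow> 'a::topological_space set"
  assumes "\<And>k. meagre (A k)"
  shows "meagre (\<Union>k. A k)"
proof -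
  have "\<forall>k. \<exists>N :: nat \<Rightarrow> 'a set. (\<forall>n. nowhere_dense (N n)) \<and> A k = (\<Union>n. N n)"
    using assms by (simp add: meagre_def)
  from choice[OF this] obtain N :: "nat \<Rightarrow> nat \<Rightarrow> 'a set"
    where N: "\<And>k n. nowhere_dense (N k n)" "\<And>k. A k = (\<Union>n. N k n)" by blast
  define N' where "N' i = (case prod_decode i of (k, n) \<Rightarrow> N k n)" for i
  have "(\<Union>k. A k) = (\<Union>i. N' i)"
  proof
    show "(\<Union>k. A k) \<subseteq> (\<Union>i. N' i)"
    proof clarsimp
      fix x k assume "x \<in> A k"
      then obtain n where "x \<in> N k n" using N(2) by blast
      then show "\<exists>i. x \<in> N' i" by (intro exI[of _ "prod_encode (k, n)"]) (simp add: N'_def)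
    qed
    show "(\<Union>i. N' i) \<subseteq> (\<Union>k. A k)" using N(2) by (auto simp: N'_def split: prod.splits)
  qed
  moreover have "nowhere_dense (N' i)" for i by (simp add: N'_def N(1) split: prod.splits)
  ultimately show ?thesis unfolding meagre_def by (intro exI[of _ N'] conjI allI)
qed

lemma meagre_Un:
  assumes "meagre S" "meagre T"
  shows "meagre (S \<union> T)"
proof -
  have "meagre (\<Union>k::nat. if k = 0 then S else T)" by (rule meagre_UN) (simp add: assms)
  moreover have "S \<union> T = (\<Union>k::nat. if k = 0 then S else T)" by (auto split: if_splits)
  ultimately show ?thesis by simp
qed

lemma open_left_translation_vimage:
  fixes V :: "'g::topological_group_add set"
  assumes "open V"
  shows "open {x. g + x \<in> V}"
proof -
  have "continuous_on UNIV (\<lambda>x. g + x)"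
    by (auto simp: continuous_on_def intro!: tendsto_intros)
  from open_vimage[OF assms this] show ?thesis by (simp add: vimage_def)
qed

lemma meagre_left_translation_vimage:
  fixes S :: "'g::topological_group_add set"
  assumes "meagre S"
  shows "meagre {x. g + x \<in> S}"
proof -
  obtain N :: "nat \<Rightarrow> 'g set" where N: "\<And>n. nowhere_dense (N n)" "S = (\<Union>n. N n)"
    using assms by (auto simp: meagre_def)
  have "nowhere_dense {x. g + x \<in> N n}" for n
    unfolding nowhere_dense_iff
  proof (intro allI impI, elim conjE)
    fix W :: "'g set" assume W: "open W" "W \<noteq> {}"
    then obtain w where "w \<in> W" by blast
    have cancel: "- g + (g + x) = x" "g + (- g + x) = x" for x by (simp_all add: add.assoc[symmetric])
    have "open {x. - g + x \<in> W}" "g + w \<in> {x. - g + x \<in> W}"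
      using W(1) \<open>w \<in> W\<close> by (auto intro: open_left_translation_vimage simp: cancel)
    then obtain V where V: "open V" "V \<noteq> {}" "V \<subseteq> {x. - g + x \<in> W}" "V \<inter> N n = {}"
      using N(1)[of n] unfolding nowhere_dense_iff by (metis empty_iff)
    from V(2) obtain v where "v \<in> V" by blast
    show "\<exists>V. open V \<and> V \<noteq> {} \<and> V \<subseteq> W \<and> V \<inter> {x. g + x \<in> N n} = {}"
    proof (intro exI conjI)
      show "open {x. g + x \<in> V}" by (rule open_left_translation_vimage[OF V(1)])
      have "- g + v \<in> {x. g + x \<in> V}" using \<open>v \<in> V\<close> by (simp add: cancel)
      then show "{x. g + x \<in> V} \<noteq> {}" by blast
      show "{x. g + x \<in> V} \<subseteq> W"
      proof
        fix x assume "x \<in> {x. g + x \<in> V}"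
        then have "- g + (g + x) \<in> W" using V(3) by blast
        then show "x \<in> W" by (simp only: cancel)
      qed
      show "{x. g + x \<in> V} \<inter> {x. g + x \<in> N n} = {}" using V(4) by auto
    qed
  qed
  moreover have "{x. g + x \<in> S} = (\<Union>n. {x. g + x \<in> N n})" using N(2) by auto
  ultimately show ?thesis unfolding meagre_def by (intro exI[of _ "\<lambda>n. {x. g + x \<in> N n}"] conjI allI)
qed

lemma open_not_meagre:
  fixes W :: "'a::complete_space set"
  assumes "open W" "W \<noteq> {}"
  shows "\<not> meagre W"
proof
  assume "meagre W"
  then obtain N :: "nat \<Rightarrow> 'a set" where N: "\<And>n. nowhere_dense (N n)" "W = (\<Union>n. N n)"
    by (auto simp: meagre_def)
  have "Met_TC.mtopology interior_of \<Union>(range (\<lambda>n. closure (N n))) = {}"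
    by (rule Met_TC.metric_Baire_category_alt)
       (use N(1) in \<open>auto simp: complete_UNIV nowhere_dense_def mcomplete_iff_complete\<close>)
  then have "interior (\<Union>n. closure (N n)) = {}" by simp
  moreover have "W \<subseteq> interior (\<Union>n. closure (N n))"
    using N(2) closure_subset assms(1) by (intro interior_maximal) fastforce+
  ultimately show False using assms(2) by blast
qed

text \<open>Pettis' theorem: \<open>A - A\<close> contains a neighbourhood of 0. \<open>A\<close> is
  comeagre in a non-empty open \<open>W\<close>, and for \<open>g\<close> near 0 the open set of
  \<open>x\<close> with \<open>x\<close> and \<open>g + x\<close> both in \<open>W\<close> is
  non-empty. Were \<open>g\<close> not such a difference, this set would be covered by
  \<open>W - A\<close> and a translate of it, against Baire's theorem.\<close>

lemma pettis:
  fixes A :: "'g::{polish_space, topological_group_add} set"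
  assumes "baire_property A" "\<not> meagre A"
  shows "\<exists>V. open V \<and> 0 \<in> V \<and> (\<forall>g\<in>V. \<exists>a\<in>A. g + a \<in> A)"
proof -
  obtain W where W: "open W" and mea: "meagre ((A - W) \<union> (W - A))"
    using assms(1) by (auto simp: baire_property_def)
  have "W \<noteq> {}" using mea assms(2) by auto
  then obtain w where "w \<in> W" by blast
  define V where "V = {g. g + w \<in> W}"
  have "continuous_on UNIV (\<lambda>g. g + w)"
    by (auto simp: continuous_on_def intro!: tendsto_intros)
  from open_vimage[OF W this] have "open V" by (simp add: V_def vimage_def)
  moreover have "0 \<in> V" using \<open>w \<in> W\<close> by (simp add: V_def)
  moreover have "\<exists>a\<in>A. g + a \<in> A" if "g \<in> V" for g
  proof (rule ccontr)
    assume none: "\<not> (\<exists>a\<in>A. g + a \<in> A)"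
    have "open (W \<inter> {x. g + x \<in> W})" by (intro open_Int W open_left_translation_vimage)
    moreover have "w \<in> W \<inter> {x. g + x \<in> W}" using that \<open>w \<in> W\<close> by (simp add: V_def)
    ultimately have "\<not> meagre (W \<inter> {x. g + x \<in> W})" using open_not_meagre by blast
    moreover have "meagre (W - A)" by (rule meagre_subset[OF mea]) auto
    then have "meagre ((W - A) \<union> {x. g + x \<in> W - A})"
      by (intro meagre_Un meagre_left_translation_vimage)
    then have "meagre (W \<inter> {x. g + x \<in> W})"
      by (rule meagre_subset) (use none in auto)
    ultimately show False by contradiction
  qed
  ultimately show ?thesis by blast
qed

section \<open>Finite unions of bounded sets\<close>

lemma group_bounded_Un:
  assumes "group_bounded A" "group_bounded B"
  shows "group_bounded (A \<union> B)"
proof (cases "A = {} \<or> B = {}")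
  case True
  then show ?thesis using assms by auto
next
  case False
  then obtain a b where ab: "a \<in> A" "b \<in> B" by blast
  show ?thesis
    unfolding group_bounded_def
  proof (intro allI impI)
    fix d :: "'a \<Rightarrow> 'a \<Rightarrow> real" assume d: "continuous_left_invariant_pseudometric d"
    then have tri: "\<And>x y z. d x z \<le> d x y + d y z" and nonneg: "\<And>x y. 0 \<le> d x y"
      and sym: "\<And>x y. d x y = d y x"
      unfolding continuous_left_invariant_pseudometric_def by blast+
    obtain C where C: "\<And>x y. x \<in> A \<Longrightarrow> y \<in> A \<Longrightarrow> d x y \<le> C"
      using assms(1) d unfolding group_bounded_def bdd_above_def by blast
    obtain C' where C': "\<And>x y. x \<in> B \<Longrightarrow> y \<in> B \<Longrightarrow> d x y \<le> C'"
      using assms(2) d unfolding group_bounded_def bdd_above_def by blast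
    have mixed: "d x y \<le> C + d a b + C'" if "x \<in> A" "y \<in> B" for x y
      using tri[of x y a] tri[of a y b] C[OF that(1) ab(1)] C'[OF ab(2) that(2)] by linarith
    have pos: "0 \<le> C" "0 \<le> C'" "0 \<le> d a b"
      using C[OF ab(1) ab(1)] C'[OF ab(2) ab(2)] nonneg[of a a] nonneg[of b b] nonneg[of a b] by linarith+
    have "d x y \<le> C + d a b + C'" if "x \<in> A \<union> B" "y \<in> A \<union> B" for x y
      using that C[of x y] C'[of x y] mixed[of x y] mixed[of y x] sym[of x y] pos by fastforce
    then show "bdd_above {d x y |x y. x \<in> A \<union> B \<and> y \<in> A \<union> B}"
      by (intro bdd_aboveI[of _ "C + d a b + C'"]) blast
  qed
qed

lemma group_bounded_UN:
  fixes A :: "nat \<Rightarrow> 'g::topological_group_add set"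
  assumes "\<And>k. group_bounded (A k)"
  shows "group_bounded (\<Union>k\<le>n. A k)"
  by (induction n) (simp_all add: assms atMost_Suc group_bounded_Un)

section \<open>Property (FH) implies weak Property (T) for \<open>\<sigma>\<close>-bounded groups\<close>

text \<open>
  The cocycle is \<open>\<beta> g = (\<Sum>n. 2\<^sup>n (F g n - F 0 n))\<close>. It converges because each \<open>g\<close> eventually moves
  \<open>F 0 n\<close> by at most \<open>4\<^sup>-\<^sup>n\<close>, and it is continuous because the convergence is uniform near \<open>0\<close>.
\<close>

locale convergent_cocycle = invariant_family F
  for F :: "'g::{polish_space, topological_group_add} \<Rightarrow> nat \<Rightarrow> 'a::{real_inner, banach}" +
  fixes j :: "'a \<Rightarrow> 'v" and V0 :: "'g set"
  assumes inj_j: "inj j"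
    and orthogonal: "n \<noteq> m \<Longrightarrow> F g n \<bullet> F h m = 0"
    and decay: "\<exists>k. \<forall>n\<ge>k. norm (F g n - F 0 n) \<le> (1/4) ^ n"
    and V0: "open V0" "0 \<in> V0"
    and uniform_decay: "\<exists>k. \<forall>n\<ge>k. \<forall>g\<in>V0. norm (F g n - F 0 n) \<le> 2 * (1/4) ^ n"
begin

sublocale T: real_transport j M
  by unfold_locales (rule inj_j subspace_M closed_M)+

definition s :: "'g \<Rightarrow> nat \<Rightarrow> 'a" where
  "s g n = 2 ^ n *\<^sub>R (F g n - F 0 n)"

definition \<beta> :: "'g \<Rightarrow> 'a" where
  "\<beta> g = (\<Sum>n. s g n)"

lemma s_in_M: "s g n \<in> M"
  unfolding s_def by (intro subspace_scale subspace_diff subspace_M F_in_M)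

lemma norm_s_le:
  assumes "norm (F g n - F 0 n) \<le> c * (1/4) ^ n"
  shows "norm (s g n) \<le> c * (1/2) ^ n"
proof -
  have "norm (s g n) \<le> 2 ^ n * (c * (1/4) ^ n)"
    unfolding s_def norm_scaleR using assms by (simp add: mult_left_mono)
  also have "2 ^ n * (c * (1/4) ^ n) = c * (2 * (1/4)) ^ n"
    by (simp only: power_mult_distrib mult_ac)
  finally show ?thesis by simp
qed

lemma summable_s: "summable (s g)"
proof -
  obtain k where k: "\<And>n. n \<ge> k \<Longrightarrow> norm (F g n - F 0 n) \<le> 1 * (1/4) ^ n"
    using decay[of g] by auto
  show ?thesis
  proof (rule summable_comparison_test)
    show "\<exists>N. \<forall>n\<ge>N. norm (s g n) \<le> 1 * (1/2) ^ n" using norm_s_le[OF k] by blast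
    show "summable (\<lambda>n. 1 * (1/2 :: real) ^ n)" by (simp add: summable_geometric)
  qed
qed

lemma partial_sum_in_M: "(\<Sum>n<N. s g n) \<in> M"
  by (intro subspace_sum subspace_M s_in_M)

lemma partial_sum_tendsto: "(\<lambda>N. \<Sum>n<N. s g n) \<longlonglongrightarrow> \<beta> g"
  unfolding \<beta>_def by (rule summable_LIMSEQ[OF summable_s])

lemma \<beta>_in_M: "\<beta> g \<in> M"
  using closed_M partial_sum_in_M partial_sum_tendsto by (metis closed_sequentially)

lemma s_add: "s (g + h) n = U g (s h n) + s g n"
proof -
  have "U g (s h n) = 2 ^ n *\<^sub>R (F (g + h) n - F g n)"
    unfolding s_def using F_in_M by (simp add: U_scaleR U_minus U_F subspace_diff[OF subspace_M])
  then show ?thesis by (simp add: s_def scaleR_right_diff_distrib)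
qed

lemma U_zero: "U g 0 = 0"
  using U_norm[OF subspace_0[OF subspace_M], of g] by simp

lemma \<beta>_add: "\<beta> (g + h) = U g (\<beta> h) + \<beta> g"
proof (rule LIMSEQ_unique[OF partial_sum_tendsto])
  have "(\<Sum>n<N. s (g + h) n) = U g (\<Sum>n<N. s h n) + (\<Sum>n<N. s g n)" for N
  proof (induction N)
    case (Suc N)
    then show ?case using U_plus[OF partial_sum_in_M s_in_M] by (simp add: s_add)
  qed (simp add: U_zero)
  moreover have "(\<lambda>N. U g (\<Sum>n<N. s h n)) \<longlonglongrightarrow> U g (\<beta> h)"
    using partial_sum_tendsto[of h]
    by (subst tendsto_dist_iff) (simp add: U_dist partial_sum_in_M \<beta>_in_M tendsto_dist_iff[symmetric])
  ultimately show "(\<lambda>N. \<Sum>n<N. s (g + h) n) \<longlonglongrightarrow> U g (\<beta> h) + \<beta> g"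
    by (simp add: tendsto_add partial_sum_tendsto)
qed

lemma \<beta>_0: "\<beta> 0 = 0"
  by (simp add: \<beta>_def s_def)

lemma tendsto_\<beta>_0:
  assumes "u \<longlonglongrightarrow> 0"
  shows "(\<lambda>k. \<beta> (u k)) \<longlonglongrightarrow> 0"
proof -
  obtain k where k: "\<And>n g. n \<ge> k \<Longrightarrow> g \<in> V0 \<Longrightarrow> norm (F g n - F 0 n) \<le> 2 * (1/4) ^ n"
    using uniform_decay by blast
  have unif: "uniform_limit V0 (\<lambda>N g. \<Sum>n<N. s g n) (\<lambda>g. \<Sum>n. s g n) sequentially"
  proof (rule Weierstrass_m_test_ev)
    show "\<forall>\<^sub>F n in sequentially. \<forall>g\<in>V0. norm (s g n) \<le> 2 * (1/2) ^ n"
      unfolding eventually_sequentially using norm_s_le[OF k] by blast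
    show "summable (\<lambda>n. 2 * (1/2 :: real) ^ n)" by (intro summable_mult summable_geometric) simp
  qed
  have "continuous_on V0 \<beta>"
    unfolding \<beta>_def
  proof (rule uniform_limit_theorem[OF _ unif trivial_limit_sequentially])
    have "continuous_on V0 (\<lambda>g. \<Sum>n<N. s g n)" for N
      unfolding s_def
      by (intro continuous_intros continuous_on_subset[OF continuous_F]) auto
    then show "\<forall>\<^sub>F N in sequentially. continuous_on V0 (\<lambda>g. \<Sum>n<N. s g n)" by simp
  qed
  then have "isCont \<beta> 0" using V0 by (simp add: continuous_on_eq_continuous_at)
  from isCont_tendsto_compose[OF this assms] show ?thesis by (simp add: \<beta>_0)
qed

text \<open>By the cocycle identity \<open>\<beta> (u k) - \<beta> a\<close> is the image under
  \<open>U a\<close> of \<open>\<beta> (- a + u k)\<close>, so continuity at 0 suffices.\<close>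

lemma tendsto_\<beta>:
  assumes "u \<longlonglongrightarrow> a"
  shows "(\<lambda>k. \<beta> (u k)) \<longlonglongrightarrow> \<beta> a"
proof (subst tendsto_dist_iff)
  have "(\<lambda>k. - a + u k) \<longlonglongrightarrow> - a + a" by (intro tendsto_intros assms)
  then have "(\<lambda>k. norm (\<beta> (- a + u k))) \<longlonglongrightarrow> 0"
    using tendsto_\<beta>_0 tendsto_norm_zero by fastforce
  moreover have "dist (\<beta> (u k)) (\<beta> a) = norm (\<beta> (- a + u k))" for k
    using \<beta>_add[of a "- a + u k"] by (simp add: add.assoc[symmetric] dist_norm U_norm \<beta>_in_M)
  ultimately show "(\<lambda>k. dist (\<beta> (u k)) (\<beta> a)) \<longlonglongrightarrow> 0" by simp
qed

definition \<alpha> :: "'g \<Rightarrow> 'v \<Rightarrow> 'v" where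
  "\<alpha> g x = j (U g (the_inv j x) + \<beta> g)"

lemma \<alpha>_j: "\<alpha> g (j u) = j (U g u + \<beta> g)"
  by (simp add: \<alpha>_def the_inv_f_f[OF inj_j])

text \<open>Strong continuity becomes joint continuity because the \<open>U g\<close> are
  isometries: changing the vector costs the same for all \<open>g\<close>.\<close>

lemma continuous_on_affine: "continuous_on (UNIV \<times> M) (\<lambda>(g, u). U g u + \<beta> g)"
  unfolding continuous_on_sequentially
proof (intro allI ballI impI, elim conjE)
  fix w :: "nat \<Rightarrow> 'g \<times> 'a" and p assume p: "p \<in> UNIV \<times> M" "\<forall>k. w k \<in> UNIV \<times> M" "w \<longlonglongrightarrow> p"
  have fst: "(\<lambda>k. fst (w k)) \<longlonglongrightarrow> fst p" and snd: "(\<lambda>k. snd (w k)) \<longlonglongrightarrow> snd p"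
    using p(3) by (auto intro: tendsto_fst tendsto_snd)
  have M: "snd p \<in> M" "snd (w k) \<in> M" for k using p(1,2) by (auto simp: mem_Times_iff)
  have U_fst: "(\<lambda>k. U (fst (w k)) (snd p)) \<longlonglongrightarrow> U (fst p) (snd p)"
    using continuous_on_tendsto_compose[OF continuous_U[OF M(1)] fst] by simp
  have U_snd: "(\<lambda>k. U (fst (w k)) (snd (w k)) - U (fst (w k)) (snd p)) \<longlonglongrightarrow> 0"
  proof (rule tendsto_norm_zero_cancel)
    have "norm (U (fst (w k)) (snd (w k)) - U (fst (w k)) (snd p)) = dist (snd (w k)) (snd p)" for k
      using U_dist[OF M(2) M(1)] by (simp add: dist_norm)
    then show "(\<lambda>k. norm (U (fst (w k)) (snd (w k)) - U (fst (w k)) (snd p))) \<longlonglongrightarrow> 0"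
      using tendsto_dist_iff[THEN iffD1, OF snd] by simp
  qed
  have "(\<lambda>k. U (fst (w k)) (snd (w k))) \<longlonglongrightarrow> U (fst p) (snd p)"
    using tendsto_add[OF U_fst U_snd] by simp
  then show "((\<lambda>(g, u). U g u + \<beta> g) \<circ> w) \<longlonglongrightarrow> (case p of (g, u) \<Rightarrow> U g u + \<beta> g)"
    by (simp add: o_def split_beta tendsto_add tendsto_\<beta>[OF fst])
qed

lemma action_\<alpha>: "continuous_affine_isometric_action T.H \<alpha>"
  unfolding continuous_affine_isometric_action_def affine_isometry_def
proof (intro conjI allI ballI)
  show "\<alpha> g ` carrier T.H \<subseteq> carrier T.H" for g
    by (auto simp: \<alpha>_j intro!: subspace_add[OF subspace_M] U_in_M \<beta>_in_M)
next
  fix g t x y assume "x \<in> carrier T.H" "y \<in> carrier T.H"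
  then obtain u v where uv: "u \<in> M" "v \<in> M" and x: "x = j u" and y: "y = j v" by auto
  have "U g ((1 - t) *\<^sub>R u + t *\<^sub>R v) + \<beta> g
      = (1 - t) *\<^sub>R (U g u + \<beta> g) + t *\<^sub>R (U g v + \<beta> g)"
    unfolding U_linear[OF uv] by (simp add: algebra_simps)
  then show "\<alpha> g ((1 - t) \<odot>\<^bsub>T.H\<^esub> x \<oplus>\<^bsub>T.H\<^esub> t \<odot>\<^bsub>T.H\<^esub> y)
      = (1 - t) \<odot>\<^bsub>T.H\<^esub> \<alpha> g x \<oplus>\<^bsub>T.H\<^esub> t \<odot>\<^bsub>T.H\<^esub> \<alpha> g y"
    by (simp add: x y \<alpha>_j)
next
  fix g x y assume "x \<in> carrier T.H" "y \<in> carrier T.H"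
  then show "hdist T.H (\<alpha> g x) (\<alpha> g y) = hdist T.H x y"
    by (auto simp: \<alpha>_j T.hdist_H U_dist U_in_M \<beta>_in_M subspace_add[OF subspace_M])
next
  fix x assume "x \<in> carrier T.H"
  then show "\<alpha> 0 x = x" by (auto simp: \<alpha>_j U_0 \<beta>_0)
next
  fix g h x assume "x \<in> carrier T.H"
  then show "\<alpha> (g + h) x = \<alpha> g (\<alpha> h x)"
    by (auto simp: \<alpha>_j U_add \<beta>_add U_plus U_in_M \<beta>_in_M add.assoc)
next
  have "continuous_map (prod_topology euclidean (htopology T.H)) (prod_topology euclidean (top_of_set M))
      (\<lambda>p. (fst p, the_inv j (snd p)))"
    unfolding continuous_map_paired
    using continuous_map_compose[OF continuous_map_snd T.continuous_map_the_inv_f]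
    by (auto simp: o_def intro: continuous_map_fst)
  moreover have "continuous_map (prod_topology euclidean (top_of_set M)) (top_of_set M)
      (\<lambda>(g, u). U g u + \<beta> g)"
  proof -
    have "prod_topology euclidean (top_of_set M) = top_of_set (UNIV \<times> M :: ('g \<times> 'a) set)"
      by (simp add: prod_topology_subtopology)
    then show ?thesis
      using continuous_on_affine
      by (auto simp: continuous_map_in_subtopology intro!: subspace_add[OF subspace_M] U_in_M \<beta>_in_M)
  qed
  ultimately have "continuous_map (prod_topology euclidean (htopology T.H)) (htopology T.H)
      (j \<circ> ((\<lambda>(g, u). U g u + \<beta> g) \<circ> (\<lambda>p. (fst p, the_inv j (snd p)))))"
    by (intro continuous_map_compose[OF _ T.continuous_map_f] continuous_map_compose)
  then show "continuous_map (prod_topology euclidean (htopology T.H)) (htopology T.H) (\<lambda>(g, x). \<alpha> g x)"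
    by (simp add: o_def case_prod_unfold \<alpha>_def)
qed

text \<open>A fixed point \<open>y\<close> gives \<open>\<beta> g = y - U g y\<close>, of norm at
  most \<open>2 * norm y\<close>. Components for different \<open>n\<close> are orthogonal, so none
  is longer than \<open>\<beta> g\<close>; pairing with \<open>w\<close> isolates the component of
  index \<open>n\<close>.\<close>

lemma displacement_bounded:
  assumes "property_FH TYPE('g) TYPE('v)"
  shows "\<exists>C. \<forall>g n. 2 ^ n * norm (F g n - F 0 n) \<le> C"
proof -
  obtain x where "x \<in> carrier T.H" "\<And>g. \<alpha> g x = x"
    using assms T.hilbert_space_H action_\<alpha> unfolding property_FH_def by blast
  then obtain y where y: "y \<in> M" "\<And>g. U g y + \<beta> g = y" by (auto simp: \<alpha>_j)
  have "norm (\<beta> g) \<le> 2 * norm y" for g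
  proof -
    have "\<beta> g = y - U g y" using y(2)[of g] by (simp add: algebra_simps)
    then show ?thesis using norm_triangle_ineq4[of y "U g y"] U_norm[OF y(1), of g] by simp
  qed
  moreover have "2 ^ n * norm (F g n - F 0 n) \<le> norm (\<beta> g)" for g n
  proof -
    define w where "w = F g n - F 0 n"
    have "s g m \<bullet> w = 0" if "m \<noteq> n" for m
      using that by (simp add: s_def w_def inner_diff_left inner_diff_right orthogonal)
    then have "(\<Sum>m. s g m \<bullet> w) = s g n \<bullet> w"
      using suminf_finite[of "{n}" "\<lambda>m. s g m \<bullet> w"] by simp
    moreover have "\<beta> g \<bullet> w = (\<Sum>m. s g m \<bullet> w)"
      unfolding \<beta>_def by (rule bounded_linear.suminf[OF bounded_linear_inner_left summable_s])
    ultimately have "\<beta> g \<bullet> w = 2 ^ n * norm w * norm w"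
      by (simp add: s_def w_def[symmetric] power2_norm_eq_inner[symmetric] power2_eq_square)
    then have "(2 ^ n * norm w) * norm w \<le> norm (\<beta> g) * norm w"
      using norm_cauchy_schwarz[of "\<beta> g" w] by simp
    then show ?thesis
      unfolding w_def[symmetric] by (cases "w = 0") (auto simp: mult_le_cancel_right)
  qed
  ultimately show ?thesis by (meson order_trans)
qed

end

theorem property_FH_imp_weak_property_T:
  assumes sigma: "sigma_bounded TYPE('g::{polish_space, topological_group_add})"
    and FH: "property_FH TYPE('g) TYPE('v)"
  shows "weak_property_T TYPE('g) TYPE('v)"
  unfolding weak_property_T_def
proof (intro allI impI, elim conjE)
  fix H :: "(complex, 'v) inner_product_space" and \<pi> :: "'g \<Rightarrow> 'v \<Rightarrow> 'v"
  assume H: "complex_hilbert_space H" and rep: "unitary_representation H \<pi>"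
    and cont: "strongly_continuous H \<pi>" and almost: "almost_invariant_vectors_bounded H \<pi>"
  \<comment> \<open>The cocycle and the circumcentre live in real spaces. Passing to real parts
    changes neither norms nor displacements.\<close>
  define R where "R = realification H"
  interpret R: real_hilbert R
    unfolding R_def by unfold_locales (rule real_hilbert_realification[OF H])
  have carrier_R: "carrier R = carrier H" by (simp add: R_def)
  have hnorm_R: "hnorm R x = hnorm H x" if "x \<in> carrier H" for x
    unfolding R_def by (rule hnorm_realification[OF H that])
  have \<pi>_in: "\<pi> g x \<in> carrier H" if "x \<in> carrier H" for g x
    using rep that unfolding unitary_representation_def unitary_operator_def bij_betw_def by blast
  have \<pi>_add: "\<pi> (g + h) x = \<pi> g (\<pi> h x)" if "x \<in> carrier H" for g h x
    using rep that unfolding unitary_representation_def by blast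
  have \<pi>_ip: "ip R (\<pi> g x) (\<pi> g y) = ip R x y" if "x \<in> carrier H" "y \<in> carrier H" for g x y
    using rep that unfolding unitary_representation_def unitary_operator_def by (simp add: R_def)
  have \<pi>_dist: "hdist R (\<pi> g x) (\<pi> g y) = hdist R x y" if "x \<in> carrier H" "y \<in> carrier H" for g x y
  proof -
    have "(hdist R (\<pi> g x) (\<pi> g y))\<^sup>2 = (hdist R x y)\<^sup>2"
      using that by (simp add: R.hdist_square \<pi>_in \<pi>_ip carrier_R)
    then show ?thesis by (simp add: power2_eq_iff_nonneg)
  qed
  \<comment> \<open>\<open>unitary_representation\<close> states multiplicativity;
    \<open>\<pi> 0\<close> is therefore idempotent, and injectivity makes it the identity.\<close>
  have \<pi>_0: "\<pi> 0 x = x" if "x \<in> carrier H" for x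
  proof -
    have "inj_on (\<pi> 0) (carrier H)"
      using rep unfolding unitary_representation_def unitary_operator_def bij_betw_def by blast
    moreover have "\<pi> 0 (\<pi> 0 x) = \<pi> 0 x" using \<pi>_add[OF that, of 0 0] by simp
    ultimately show ?thesis using that \<pi>_in by (auto dest: inj_onD)
  qed
  obtain A :: "nat \<Rightarrow> 'g set" where A: "\<And>n. group_bounded (A n)" "\<And>n. baire_property (A n)"
      "(\<Union>n. A n) = UNIV"
    using sigma unfolding sigma_bounded_def by blast
  have "\<exists>\<xi>\<in>carrier H. hnorm H \<xi> = 1 \<and> (\<forall>k\<le>n. \<forall>g\<in>A k. hdist R (\<pi> g \<xi>) \<xi> \<le> (1/4) ^ n)" for n
  proof -
    have "\<exists>\<xi>\<in>carrier H. hnorm H \<xi> = 1 \<and>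
        (SUP g\<in>(\<Union>k\<le>n. A k). ereal (hnorm H (\<pi> g \<xi> \<ominus>\<^bsub>H\<^esub> \<xi>))) < ereal ((1/4) ^ n)"
      using almost group_bounded_UN[of A n, OF A(1)]
      unfolding almost_invariant_vectors_bounded_def by simp
    then obtain \<xi> where \<xi>: "\<xi> \<in> carrier H" "hnorm H \<xi> = 1"
      and sup: "(SUP g\<in>(\<Union>k\<le>n. A k). ereal (hnorm H (\<pi> g \<xi> \<ominus>\<^bsub>H\<^esub> \<xi>))) < ereal ((1/4) ^ n)"
      by blast
    have "hdist R (\<pi> g \<xi>) \<xi> \<le> (1/4) ^ n" if "k \<le> n" "g \<in> A k" for k g
    proof -
      have "ereal (hnorm H (\<pi> g \<xi> \<ominus>\<^bsub>H\<^esub> \<xi>)) < ereal ((1/4) ^ n)"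
        by (rule SUP_lessD[OF sup]) (use that in blast)
      moreover have "hdist R (\<pi> g \<xi>) \<xi> = hnorm H (\<pi> g \<xi> \<ominus>\<^bsub>H\<^esub> \<xi>)"
        using \<xi>(1) \<pi>_in[OF \<xi>(1)] unfolding R_def hdist_realification[OF H] by (simp add: hdist_def)
      ultimately show ?thesis by simp
    qed
    then show ?thesis using \<xi> by blast
  qed
  then obtain \<xi> where \<xi>: "\<And>n. \<xi> n \<in> carrier H" and unit: "\<And>n. hnorm H (\<xi> n) = 1"
    and decay: "\<And>n k g. k \<le> n \<Longrightarrow> g \<in> A k \<Longrightarrow> hdist R (\<pi> g (\<xi> n)) (\<xi> n) \<le> (1/4) ^ n"
    by metis
  have ip_unit: "ip R (\<xi> n) (\<xi> n) = 1" for n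
    using R.hnorm_square[of "\<xi> n"] \<xi>[of n] by (simp add: carrier_R hnorm_R unit)
  define K where "K n g h = ip R (\<pi> g (\<xi> n)) (\<pi> h (\<xi> n))" for n g h
  have in_R: "\<pi> g (\<xi> n) \<in> carrier R" for g n by (simp add: carrier_R \<pi>_in \<xi>)
  \<comment> \<open>For unit vectors the real inner product is a function of the distance, so
    continuity of \<open>K n\<close> reduces to that of orbit maps.\<close>
  have K_dist: "K n g h = 1 - (hdist R (\<pi> g (\<xi> n)) (\<pi> h (\<xi> n)))\<^sup>2 / 2" for n g h
    by (simp add: R.hdist_square in_R K_def \<pi>_ip \<xi> ip_unit diff_divide_distrib)
  have orbit_cont: "continuous_map euclidean (htopology R) (\<lambda>g. \<pi> g (\<xi> n))" for n
    using cont \<xi> unfolding strongly_continuous_def htopology_def carrier_R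
    by (simp add: R_def hdist_realification[OF H])
  obtain F :: "'g \<Rightarrow> nat \<Rightarrow> ell2" where F: "invariant_family F"
    and gram: "\<And>g h n m. F g n \<bullet> F h m = (if n = m then K n g h else 0)"
  proof -
    have "psd_kernel (K n)" for n
      using R.psd_kernel_ip[of "\<lambda>g. \<pi> g (\<xi> n)"] in_R by (simp add: K_def[abs_def])
    moreover have "(\<lambda>k. K n (u k) (v k)) \<longlonglongrightarrow> K n x y" if "u \<longlonglongrightarrow> x" "v \<longlonglongrightarrow> y" for n u v x y
      unfolding K_dist by (intro tendsto_intros R.tendsto_hdist2[OF orbit_cont in_R] that) simp
    moreover have "K n (a + g) (a + h) = K n g h" for n a g h
      by (simp add: K_def \<pi>_add \<pi>_ip \<pi>_in \<xi>)
    ultimately show ?thesis using psd_kernels_gram_family[of K] that by metis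
  qed
  have norm_F: "norm (F g n - F h n) = hdist R (\<pi> g (\<xi> n)) (\<pi> h (\<xi> n))" for g h n
  proof -
    have "(norm (F g n - F h n))\<^sup>2 = (hdist R (\<pi> g (\<xi> n)) (\<pi> h (\<xi> n)))\<^sup>2"
      using dist_gram_square[of "F g n" "F h n"] by (simp add: gram K_def R.hdist_square in_R dist_norm)
    then show ?thesis by (simp add: power2_eq_iff_nonneg)
  qed
  have moved: "norm (F g n - F 0 n) \<le> (1/4) ^ n" if "k \<le> n" "g \<in> A k" for g n k
    using decay[OF that] by (simp add: norm_F \<pi>_0 \<xi>)
  \<comment> \<open>A Polish space is not a countable union of meagre sets.\<close>
  have "\<exists>k. \<not> meagre (A k)"
    using meagre_UN[of A] open_not_meagre[of "UNIV :: 'g set"] A(3) by auto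
  then obtain k where "\<not> meagre (A k)" by blast
  from pettis[OF A(2) this] obtain V0
    where V0: "open V0" "0 \<in> V0" "\<And>g. g \<in> V0 \<Longrightarrow> \<exists>a\<in>A k. g + a \<in> A k" by blast
  \<comment> \<open>\<open>g\<close> is the difference of \<open>g + a\<close> and \<open>a\<close>,
    both in \<open>A k\<close>. Each contributes a displacement of at most \<open>(1/4) ^ n\<close>,
    whence the factor 2.\<close>
  have near: "norm (F g n - F 0 n) \<le> 2 * (1/4) ^ n" if n: "n \<ge> k" and g: "g \<in> V0" for n g
  proof -
    obtain a where a: "a \<in> A k" "g + a \<in> A k" using V0(3)[OF g] by blast
    have "norm (F g n - F (g + a) n) = norm (F 0 n - F a n)"
      unfolding norm_F using \<pi>_dist[OF \<pi>_in[OF \<xi>] \<pi>_in[OF \<xi>], of g 0 n a n] \<pi>_add[OF \<xi>, of g 0 n]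
      by (simp add: \<pi>_add \<xi>)
    then show ?thesis
      using norm_triangle_ineq[of "F g n - F (g + a) n" "F (g + a) n - F 0 n"]
        moved[OF n a(1)] moved[OF n a(2)] by (simp add: norm_minus_commute)
  qed
  have "\<xi> 0 \<noteq> \<zero>\<^bsub>R\<^esub>" using ip_unit[of 0] R.ip_zero[of "\<zero>\<^bsub>R\<^esub>"] by auto
  from R.ex_inj_ell2_prod[OF _ this] obtain j' :: "ell2 \<times> ell2 \<Rightarrow> 'v" where "inj j'"
    using \<xi> by (auto simp: carrier_R)
  \<comment> \<open>The affine action lives on a real space, so the injection of pairs is restricted
    to the first factor.\<close>
  then have j: "inj (\<lambda>x. j' (x, 0))" by (auto simp: inj_def)
  interpret convergent_cocycle F "\<lambda>x. j' (x, 0)" V0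
  proof (intro convergent_cocycle.intro convergent_cocycle_axioms.intro F j V0(1,2))
    show "F g n \<bullet> F h m = 0" if "n \<noteq> m" for n m g h using that by (simp add: gram)
    show "\<exists>k. \<forall>n\<ge>k. norm (F g n - F 0 n) \<le> (1/4) ^ n" for g
    proof -
      obtain l where "g \<in> A l" using A(3) by blast
      then show ?thesis using moved by blast
    qed
    show "\<exists>k. \<forall>n\<ge>k. \<forall>g\<in>V0. norm (F g n - F 0 n) \<le> 2 * (1/4) ^ n" using near by blast
  qed
  obtain C where C: "\<And>g n. 2 ^ n * norm (F g n - F 0 n) \<le> C"
    using displacement_bounded[OF FH] by blast
  \<comment> \<open>\<open>C\<close> is the same for all indices, so the weight \<open>2 ^ n\<close>
    eventually forces displacements below 1/2.\<close>
  obtain n where "2 * C < 2 ^ n" using real_arch_pow[of 2 "2 * C"] by auto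
  have close: "hdist R z (\<xi> n) \<le> 1/2" if "z \<in> range (\<lambda>g. \<pi> g (\<xi> n))" for z
  proof -
    from that obtain g where "z = \<pi> g (\<xi> n)" by blast
    then have "hdist R z (\<xi> n) = norm (F g n - F 0 n)" by (simp add: norm_F \<pi>_0 \<xi>)
    moreover have "2 ^ n * (2 * norm (F g n - F 0 n)) < 2 ^ n * 1"
      using C[of n g] \<open>2 * C < 2 ^ n\<close> by linarith
    then have "2 * norm (F g n - F 0 n) < 1" by (simp only: mult_less_cancel_left_pos zero_less_power zero_less_numeral)
    ultimately show ?thesis by simp
  qed
  obtain c where c: "c \<in> carrier R" "\<And>z. z \<in> range (\<lambda>g. \<pi> g (\<xi> n)) \<Longrightarrow> hdist R z c \<le> 1/2"
    and fix_c: "\<And>f. (\<And>x. x \<in> carrier R \<Longrightarrow> f x \<in> carrier R) \<Longrightarrow>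
         (\<And>x y. x \<in> carrier R \<Longrightarrow> y \<in> carrier R \<Longrightarrow> hdist R (f x) (f y) = hdist R x y) \<Longrightarrow>
         range (\<lambda>g. \<pi> g (\<xi> n)) \<subseteq> f ` range (\<lambda>g. \<pi> g (\<xi> n)) \<Longrightarrow> f c = c"
    by (rule R.circumcentre[of "range (\<lambda>g. \<pi> g (\<xi> n))" "\<xi> n" "1/2"])
       (use close in_R \<xi> carrier_R in auto)
  have "\<pi> g c = c" for g
  proof (rule fix_c)
    have "\<pi> h (\<xi> n) = \<pi> g (\<pi> (- g + h) (\<xi> n))" for h
      by (simp add: \<pi>_add[OF \<xi>, symmetric] add.assoc[symmetric])
    then show "range (\<lambda>g. \<pi> g (\<xi> n)) \<subseteq> \<pi> g ` range (\<lambda>g. \<pi> g (\<xi> n))" by blast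
  qed (simp_all add: carrier_R \<pi>_in \<pi>_dist)
  \<comment> \<open>The zero vector has distance 1 from the unit vector \<open>\<xi> n\<close>, but
    \<open>c\<close> has distance at most 1/2.\<close>
  moreover have "c \<noteq> \<zero>\<^bsub>H\<^esub>"
  proof
    assume "c = \<zero>\<^bsub>H\<^esub>"
    then have zero: "c = \<zero>\<^bsub>R\<^esub>" by (simp add: R_def)
    have "\<xi> n \<in> carrier R" by (simp add: carrier_R \<xi>)
    then have "(hdist R (\<xi> n) c)\<^sup>2 = 1"
      unfolding zero by (simp add: R.hdist_square ip_unit R.ip_zero R.ip_sym[of "\<xi> n" "\<zero>\<^bsub>R\<^esub>"])
    moreover have "hdist R (\<xi> n) c \<le> 1/2"
      using c(2)[of "\<xi> n"] \<pi>_0[OF \<xi>[of n]] by (metis rangeI)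
    then have "(hdist R (\<xi> n) c)\<^sup>2 \<le> (1/2)\<^sup>2" by (intro power_mono) auto
    ultimately show False by (simp add: power2_eq_square)
  qed
  ultimately show "has_nonzero_invariant_vector H \<pi>"
    unfolding has_nonzero_invariant_vector_def using c(1) carrier_R by blast
qed

theorem proposition2p13:
  shows "(weak_property_T TYPE('g::{polish_space, topological_group_add}) TYPE('v) \<longrightarrow>
            property_FH TYPE('g) TYPE('v)) \<and>
         (sigma_bounded TYPE('g) \<and> property_FH TYPE('g) TYPE('v) \<longrightarrow>
            weak_property_T TYPE('g) TYPE('v))"
  using weak_property_T_imp_property_FH property_FH_imp_weak_property_T by blast

end
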